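(* The algebra $Z_2(sl(3))^{spec}$ is invariant under the action of the Weyl group $W(E_6)$ of type $E_6$ on the parameters $m_1,m_2,m'_1,m'_2,m''_1,m''_2$ given in the context. Moreover, the polynomials $a_2,a_5,a_6,a_8,a_9,a_{12}$ (viewed as polynomials in $m_1,m_2,m'_1,m'_2,m''_1,m''_2$) are expressed in terms of the fundamental invariant polynomials $p_2,p_5,p_6,p_8,p_9,p_{12}$ of $W(E_6)$ as follows: $$a_2=p_2-3,\qquad a_5=-p_5,\qquad a_6=p_6+\frac{p_2^3}{9}+\frac{2p_2^2}{3}-\frac{3p_2}{2}+1,$$ $$a_8=-p_8+\frac{p_2^4}{54}+\frac{p_2p_6}{12}+\frac{p_2^3}{18}+\frac{p_6}{2}+\frac{p_2^2}{6}-\frac{p_2}{4}+\frac18,$$ $$a_9=-p_9-p_5\left(\frac{p_2^2}{27}+\frac{p_2}{3}-\frac14\right),$$ $$a_{12}=-p_{12}+\frac{35p_6^2}{12}+\frac{p_2^6}{36}+\frac{17p_2^3p_6}{72}-\frac{p_2^2p_8}{18}-\frac{7p_2p_5^2}{18}+\frac{p_2^5}{162}-\frac{p_2p_8}{3}+\frac{p_2^2p_6}{36}-\frac{p_5^2}{4}$$ $$\qquad-\frac{13p_2^4}{108}+\frac{13p_8}{2}-\frac{13p_2p_6}{24}-\frac{19p_2^3}{54}-3p_6-\frac{11p_2^2}{12}+\frac{11p_2}{8}-\frac{11}{16}.$$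
   Context: **The algebra $Z_2(sl(3))^{spec}$.** Let $Z_2(sl(3))$ be the centraliser of the diagonal embedding of $U(sl(3))$ in $U(sl(3))\otimes U(sl(3))$. Its specialisation $Z_2(sl(3))^{spec}$, attached to parameters $m_1,m_2,m'_1,m'_2,m''_1,m''_2$, fixes the Casimir elements of the first copy, second copy and diagonal copy of $U(sl(3))$ to their values on highest-weight modules of $sl(3)$ with highest weights (coefficients on fundamental weights) $(m_1-1,m_2-1)$, $(m'_1-1,m'_2-1)$, $(m''_1-1,m''_2-1)$ respectively. It is the algebra with generators $X,Y,Z$ and defining relations $$[X,Y]=Z,\quad [X,Z]=-6Y^2+a_2X^2+a_5X+a_8,\quad [Y,Z]=-2X^3-a_2\{X,Y\}-a_5Y+a_6X+a_9,$$ $$x_1X+x_2Y+x_3X^2+x_4\{X,Y\}+x_5Y^2+x_7XYX-X^4+4Y^3+Z^2=a_{12},$$ with $\{X,Y\}=XY+YX$, $x_1=6a_5+2a_9$, $x_2=-2a_6-2a_8$, $x_3=6a_2+a_6$, $x_4=-a_5$, $x_5=8a_2-24$, $x_7=-2a_2+12$, and the $a_i$ below. Invariance under $W(E_6)$ means that transforming the parameters $m_1,\dots,m''_2$ by the action of any element of $W(E_6)$ (leaving $X,Y,Z$ fixed) leaves these defining relations unchanged. **The polynomials $a_i$.** $S_3$ acts on $\mathbb{C}[k_1,k_2,k_3,l_1,l_2,l_3]$ by simultaneously permuting the indices of the $k_i$ and of the $l_i$; $Sym^+=\frac16\sum_{\pi}\pi$, $Sym^-=\frac16\sum_{\pi}\mathrm{sgn}(\pi)\pi$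 (sums over $S_3$). $$a_2=\tfrac12(k_1+k_2+k_3),\qquad a_5=Sym^-(2k_2l_1),$$ $$a_6=Sym^+\Bigl(\tfrac1{16}(-k_1^3+2k_1^2k_2-6k_1k_2k_3)+\tfrac38(k_1^2-2k_1k_2)+\tfrac16l_1^2-\tfrac53l_1l_2\Bigr),$$ $$a_8=Sym^+\Bigl(\tfrac1{128}(k_1^4-8k_1^3k_2+6k_1^2k_2^2+4k_1^2k_2k_3)-\tfrac1{32}(3k_1^3-6k_1^2k_2+2k_1k_2k_3)-\tfrac1{24}k_1(l_1^2-6l_2^2+4l_1l_2-26l_2l_3)+\tfrac12l_1^2+l_1l_2\Bigr),$$ $$a_9=Sym^-\Bigl(l_2\bigl(-\tfrac49l_1^2+\tfrac1{24}(k_1^3-2k_1^2k_2+k_1k_2^2+9k_1^2k_3)+\tfrac12(k_1^2-k_1k_2)\bigr)\Bigr),$$ and $a_{12}$ is $$\begin{array}{l} Sym^+\Bigl( \frac{1}{4608}k_1^6 - \frac{1}{768}k_1^5 (1 + 2 k_2) + \frac{1}{768} k_1^4 (-39 + 6 k_2 + 5 k_2^2 + 3 k_2 k_3)-\frac{1}{1152}k_1^3 (-648 - 468 k_2 \\ \quad + 6 k_2^2 + 5 k_2^3 - 6 k_2 k_3 + 6 k_2^2 k_3 + 2 l_1^2 + 8 l_1 l_2 - 12 l_2^2 + 140 l_2 l_3) - \frac{1}{2304}k_1^2 (2592 k_2 + 702 k_2^2 \\ \quad + 468 k_2 k_3 + 42 k_2^2 k_3 + k_2^2 k_3^2 - 40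 l_1^2 - 40 k_2 l_1^2 + 416 l_1 l_2 - 16 k_2 l_1 l_2 + 144 k_3 l_1 l_2 - 464 l_2^2 \\ \quad + 56 k_2 l_2^2 - 360 k_3 l_2^2 - 560 l_2 l_3 - 720 k_3 l_2 l_3) -\frac{1}{288} k_1 (-108 k_2 k_3 - 24 l_1^2 + 68 k_2 l_1^2 + 17 k_2 k_3 l_1^2 \\ \quad - 672 l_1 l_2 - 52 k_2 l_1 l_2 - 296 k_3 l_1 l_2 - 2 k_2 k_3 l_1 l_2 - 48 l_2^2 - 206 k_3 l_2^2 + 1392 l_2 l_3) + \frac{1}{432}l_1 (-864 l_1 \\ \quad + l_1^3 - 1728 l_2 + 24 l_1^2 l_2 - 26 l_1 l_2^2 + 244 l_1 l_2 l_3)\Bigr). \end{array}$$ In all of these, $k_1,k_2,k_3,l_1,l_2,l_3$ are replaced by $$k_1=c^{(2)}(m_1,m_2),\quad k_2=c^{(2)}(m'_1,m'_2),\quad k_3=c^{(2)}(m''_1,m''_2),$$ $$l_1=c^{(3)}(m_1,m_2)+\tfrac32c^{(2)}(m_1,m_2),\quad l_2=c^{(3)}(m'_1,m'_2)+\tfrac32c^{(2)}(m'_1,m'_2),\quad l_3=-c^{(3)}(m''_1,m''_2)-\tfrac32c^{(2)}(m''_1,m''_2),$$ where $$c^{(2)}(m_1,m_2)=\tfrac23(m_1^2+m_2^2+m_1m_2)-2,\qquad c^{(3)}(m_1,m_2)=\tfrac19(m_1+2m_2-3)(2m_1+m_2+3)(m_1-m_2-3).$$ **The action of $W(E_6)$.**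 Let $\alpha_1,\dots,\alpha_6$ be simple roots of type $E_6$, where in the Dynkin diagram $1-2-3-4-5$ is a chain and $6$ is attached to $3$, and let $\Theta$ be the longest positive root. Identify $m_1=\alpha_1$, $m_2=\alpha_2$, $m'_1=\alpha_5$, $m'_2=\alpha_4$, $m''_1=\Theta$, $m''_2=-\alpha_6$, so that $\alpha_3=\frac13\bigl(m''_1+2m''_2-(m_1+2m_2)-(m'_1+2m'_2)\bigr)$. The reflection representation of $W(E_6)$, generated by the simple reflections $s_1,\dots,s_6$, acts on the parameters by (unlisted parameters are fixed) $$s_1: m_1\mapsto -m_1,\ m_2\mapsto m_1+m_2;\qquad s_2: m_1\mapsto m_1+m_2,\ m_2\mapsto -m_2;$$ $$s_5: m'_1\mapsto -m'_1,\ m'_2\mapsto m'_1+m'_2;\qquad s_4: m'_1\mapsto m'_1+m'_2,\ m'_2\mapsto -m'_2;$$ $$s_6: m''_1\mapsto m''_1+m''_2,\ m''_2\mapsto -m''_2;\qquad s_3: m_2\mapsto m_2+\alpha_3,\ m'_2\mapsto m'_2+\alpha_3,\ m''_2\mapsto m''_2-\alpha_3,$$ and this extends to an action by algebra automorphisms on $\mathbb{C}[m_1,m_2,m'_1,m'_2,m''_1,m''_2]$. **Fundamental invariants.** With $\langle f\rangle=\frac1{51840}\sum_{s\in W(E_6)}s(f)$ (where $51840=|W(E_6)|$), set $$p_2=\tfrac32\langle m_1^2\rangle,\quad p_5=\tfrac83\langle (m'_1)^2m'_2m''_1m''_2\rangle,\quad p_6=10\langle m_1m_2m'_1m'_2m''_1m''_2\rangle,$$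 $$p_8=\tfrac53\langle (m_1)^2m_2(m'_1)^2m'_2m''_1m''_2\rangle,\quad p_9=\tfrac{40}{27}\langle (m_1m_2m'_1)^2m'_2m''_1m''_2\rangle,\quad p_{12}=\tfrac{20}{3}\langle (m_1m_2m'_1m'_2m''_1m''_2)^2\rangle.$$ These are a choice of six fundamental homogeneous invariant polynomials (algebraically independent generators of the algebra of invariants) of $W(E_6)$. *)

theory Defs
  imports
    Complex_Main
    "HOL-Library.Poly_Mapping"
    "HOL-Combinatorics.Permutations"
    "HOL-Algebra.QuotRing"
begin

section \<open>Polynomials and free algebras over the complex numbers\<close>

text \<open>
  The monoid algebra of a monoid \<open>'m\<close> (written additively) over the complex numbers is
  \<open>'m \<Rightarrow>\<^sub>0 complex\<close>. The multivariate polynomial ring with variables from \<open>'v\<close> is the case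
  of the commutative monoid \<open>'v \<Rightarrow>\<^sub>0 nat\<close> of monomials; the free associative algebra on \<open>'g\<close>
  is the case of the monoid of words over \<open>'g\<close>.
\<close>

type_synonym 'v mpoly = "('v \<Rightarrow>\<^sub>0 nat) \<Rightarrow>\<^sub>0 complex"

definition Const :: "complex \<Rightarrow> ('m::monoid_add \<Rightarrow>\<^sub>0 complex)" where
  "Const c = Poly_Mapping.single 0 c"

definition Var :: "'v \<Rightarrow> 'v mpoly" where
  "Var v = Poly_Mapping.single (Poly_Mapping.single v 1) 1"

definition insertion ::
  "(complex \<Rightarrow> 'b::comm_ring_1) \<Rightarrow> ('v \<Rightarrow> 'b) \<Rightarrow> 'v mpoly \<Rightarrow> 'b" where
  "insertion \<phi> \<sigma> p =
     (\<Sum>m\<in>Poly_Mapping.keys p.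
        \<phi> (Poly_Mapping.lookup p m) *
        (\<Prod>v\<in>Poly_Mapping.keys m. \<sigma> v ^ Poly_Mapping.lookup m v))"

definition subst :: "('v \<Rightarrow> 'w mpoly) \<Rightarrow> 'v mpoly \<Rightarrow> 'w mpoly" where
  "subst = insertion Const"

definition peval :: "('v \<Rightarrow> complex) \<Rightarrow> 'v mpoly \<Rightarrow> complex" where
  "peval = insertion (\<lambda>c. c)"

datatype 'g fword = FWord (letters: "'g list")

instantiation fword :: (type) monoid_add
begin

definition zero_fword :: "'a fword" where
  "0 = FWord []"

definition plus_fword :: "'a fword \<Rightarrow> 'a fword \<Rightarrow> 'a fword" where
  "u + v = FWord (letters u @ letters v)"

instance
  by standard (simp_all add: zero_fword_def plus_fword_def)

end

type_synonym 'g free_alg = "'g fword \<Rightarrow>\<^sub>0 complex"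

definition Gen :: "'g \<Rightarrow> 'g free_alg" where
  "Gen g = Poly_Mapping.single (FWord [g]) 1"

text \<open>The ring structure of the free algebra as a record, with scalars embedded by \<^const>\<open>Const\<close>.\<close>

definition free_algebra :: "'g free_alg ring" where
  "free_algebra = \<lparr>carrier = UNIV, mult = (*), one = 1, zero = 0, add = (+)\<rparr>"

text \<open>
  \<^const>\<open>genideal\<close> is the two-sided ideal generated by a set, so this is the algebra presented
  by the given equations between noncommutative polynomials.
\<close>

definition presented_algebra :: "('g free_alg \<times> 'g free_alg) list \<Rightarrow> 'g free_alg set ring" where
  "presented_algebra rels =
     free_algebra Quot (Idl\<^bsub>free_algebra\<^esub> {l - r |l r. (l, r) \<in> set rels})"


section \<open>The parameters and the action of the Weyl group\<close>

datatype par = M1 | M2 | M1' | M2' | M1'' | M2''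

abbreviation m1 :: "par mpoly" where "m1 \<equiv> Var M1"
abbreviation m2 :: "par mpoly" where "m2 \<equiv> Var M2"
abbreviation m1' :: "par mpoly" where "m1' \<equiv> Var M1'"
abbreviation m2' :: "par mpoly" where "m2' \<equiv> Var M2'"
abbreviation m1'' :: "par mpoly" where "m1'' \<equiv> Var M1''"
abbreviation m2'' :: "par mpoly" where "m2'' \<equiv> Var M2''"

text \<open>
  Simple roots of type \<open>E\<^sub>6\<close> with chain \<open>1 - 2 - 3 - 4 - 5\<close> and \<open>6\<close> attached to \<open>3\<close>:
  \<open>\<alpha>\<^sub>1 = m1\<close>, \<open>\<alpha>\<^sub>2 = m2\<close>, \<open>\<alpha>\<^sub>5 = m1'\<close>, \<open>\<alpha>\<^sub>4 = m2'\<close>, \<open>\<alpha>\<^sub>6 = - m2''\<close>, and \<open>m1''\<close> is the longest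
  positive root \<open>\<alpha>\<^sub>1 + 2 \<alpha>\<^sub>2 + 3 \<alpha>\<^sub>3 + 2 \<alpha>\<^sub>4 + \<alpha>\<^sub>5 + 2 \<alpha>\<^sub>6\<close>, which determines \<open>\<alpha>\<^sub>3\<close>.
\<close>

definition \<alpha>\<^sub>3 :: "par mpoly" where
  "\<alpha>\<^sub>3 = Const (1/3) * ((m1'' + 2 * m2'') - (m1 + 2 * m2) - (m1' + 2 * m2'))"

definition s1 :: "par mpoly \<Rightarrow> par mpoly" where
  "s1 = subst (Var(M1 := - m1, M2 := m1 + m2))"
definition s2 :: "par mpoly \<Rightarrow> par mpoly" where
  "s2 = subst (Var(M1 := m1 + m2, M2 := - m2))"
definition s3 :: "par mpoly \<Rightarrow> par mpoly" where
  "s3 = subst (Var(M2 := m2 + \<alpha>\<^sub>3, M2' := m2' + \<alpha>\<^sub>3, M2'' := m2'' - \<alpha>\<^sub>3))"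
definition s4 :: "par mpoly \<Rightarrow> par mpoly" where
  "s4 = subst (Var(M1' := m1' + m2', M2' := - m2'))"
definition s5 :: "par mpoly \<Rightarrow> par mpoly" where
  "s5 = subst (Var(M1' := - m1', M2' := m1' + m2'))"
definition s6 :: "par mpoly \<Rightarrow> par mpoly" where
  "s6 = subst (Var(M1'' := m1'' + m2'', M2'' := - m2''))"

text \<open>
  \<open>W(E\<^sub>6)\<close> is realised as the group of algebra automorphisms of the polynomial ring in the
  parameters generated by the simple reflections. These are involutions, so closing under
  composition with them suffices to obtain the generated group.
\<close>

inductive_set W_E6 :: "(par mpoly \<Rightarrow> par mpoly) set" where
  W_E6_id: "id \<in> W_E6"
| W_E6_step: "s \<in> {s1, s2, s3, s4, s5, s6} \<Longrightarrow> w \<in> W_E6 \<Longrightarrow> s \<circ> w \<in> W_E6"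

text \<open>The values taken at \<open>\<mu>\<close> by the parameters after transforming them by \<open>w\<close>.\<close>

definition transform :: "(par mpoly \<Rightarrow> par mpoly) \<Rightarrow> (par \<Rightarrow> complex) \<Rightarrow> (par \<Rightarrow> complex)" where
  "transform w \<mu> = (\<lambda>x. peval \<mu> (w (Var x)))"

definition W_average :: "par mpoly \<Rightarrow> par mpoly" where
  "W_average f = Const (1/51840) * (\<Sum>s\<in>W_E6. s f)"

definition p2 :: "par mpoly" where
  "p2 = Const (3/2) * W_average (m1^2)"
definition p5 :: "par mpoly" where
  "p5 = Const (8/3) * W_average (m1'^2 * m2' * m1'' * m2'')"
definition p6 :: "par mpoly" where
  "p6 = 10 * W_average (m1 * m2 * m1' * m2' * m1'' * m2'')"
definition p8 :: "par mpoly" where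
  "p8 = Const (5/3) * W_average (m1^2 * m2 * m1'^2 * m2' * m1'' * m2'')"
definition p9 :: "par mpoly" where
  "p9 = Const (40/27) * W_average ((m1 * m2 * m1')^2 * m2' * m1'' * m2'')"
definition p12 :: "par mpoly" where
  "p12 = Const (20/3) * W_average ((m1 * m2 * m1' * m2' * m1'' * m2'')^2)"


section \<open>The structure constants as polynomials in \<open>k\<^sub>i\<close> and \<open>l\<^sub>i\<close>\<close>

datatype idx = I1 | I2 | I3

datatype kl = K idx | L idx

abbreviation k1 :: "kl mpoly" where "k1 \<equiv> Var (K I1)"
abbreviation k2 :: "kl mpoly" where "k2 \<equiv> Var (K I2)"
abbreviation k3 :: "kl mpoly" where "k3 \<equiv> Var (K I3)"
abbreviation l1 :: "kl mpoly" where "l1 \<equiv> Var (L I1)"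
abbreviation l2 :: "kl mpoly" where "l2 \<equiv> Var (L I2)"
abbreviation l3 :: "kl mpoly" where "l3 \<equiv> Var (L I3)"

definition perm_act :: "(idx \<Rightarrow> idx) \<Rightarrow> kl mpoly \<Rightarrow> kl mpoly" where
  "perm_act \<pi> = subst (case_kl (\<lambda>i. Var (K (\<pi> i))) (\<lambda>i. Var (L (\<pi> i))))"

definition Sym_plus :: "kl mpoly \<Rightarrow> kl mpoly" where
  "Sym_plus f = Const (1/6) * (\<Sum>\<pi> | \<pi> permutes UNIV. perm_act \<pi> f)"

definition Sym_minus :: "kl mpoly \<Rightarrow> kl mpoly" where
  "Sym_minus f = Const (1/6) * (\<Sum>\<pi> | \<pi> permutes UNIV. of_int (sign \<pi>) * perm_act \<pi> f)"

definition a2_kl :: "kl mpoly" where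
  "a2_kl = Const (1/2) * (k1 + k2 + k3)"

definition a5_kl :: "kl mpoly" where
  "a5_kl = Sym_minus (2 * k2 * l1)"

definition a6_kl :: "kl mpoly" where
  "a6_kl = Sym_plus
     (Const (1/16) * (- (k1^3) + 2 * k1^2 * k2 - 6 * k1 * k2 * k3)
      + Const (3/8) * (k1^2 - 2 * k1 * k2)
      + Const (1/6) * l1^2 - Const (5/3) * l1 * l2)"

definition a8_kl :: "kl mpoly" where
  "a8_kl = Sym_plus
     (Const (1/128) * (k1^4 - 8 * k1^3 * k2 + 6 * k1^2 * k2^2 + 4 * k1^2 * k2 * k3)
      - Const (1/32) * (3 * k1^3 - 6 * k1^2 * k2 + 2 * k1 * k2 * k3)
      - Const (1/24) * k1 * (l1^2 - 6 * l2^2 + 4 * l1 * l2 - 26 * l2 * l3)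
      + Const (1/2) * l1^2 + l1 * l2)"

definition a9_kl :: "kl mpoly" where
  "a9_kl = Sym_minus
     (l2 * (- Const (4/9) * l1^2
            + Const (1/24) * (k1^3 - 2 * k1^2 * k2 + k1 * k2^2 + 9 * k1^2 * k3)
            + Const (1/2) * (k1^2 - k1 * k2)))"

definition a12_kl :: "kl mpoly" where
  "a12_kl = Sym_plus
     (Const (1/4608) * k1^6
      - Const (1/768) * k1^5 * (1 + 2 * k2)
      + Const (1/768) * k1^4 * (- 39 + 6 * k2 + 5 * k2^2 + 3 * k2 * k3)
      - Const (1/1152) * k1^3 *
          (- 648 - 468 * k2 + 6 * k2^2 + 5 * k2^3 - 6 * k2 * k3 + 6 * k2^2 * k3
           + 2 * l1^2 + 8 * l1 * l2 - 12 * l2^2 + 140 * l2 * l3)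
      - Const (1/2304) * k1^2 *
          (2592 * k2 + 702 * k2^2 + 468 * k2 * k3 + 42 * k2^2 * k3 + k2^2 * k3^2
           - 40 * l1^2 - 40 * k2 * l1^2 + 416 * l1 * l2 - 16 * k2 * l1 * l2
           + 144 * k3 * l1 * l2 - 464 * l2^2 + 56 * k2 * l2^2 - 360 * k3 * l2^2
           - 560 * l2 * l3 - 720 * k3 * l2 * l3)
      - Const (1/288) * k1 *
          (- 108 * k2 * k3 - 24 * l1^2 + 68 * k2 * l1^2 + 17 * k2 * k3 * l1^2
           - 672 * l1 * l2 - 52 * k2 * l1 * l2 - 296 * k3 * l1 * l2
           - 2 * k2 * k3 * l1 * l2 - 48 * l2^2 - 206 * k3 * l2^2 + 1392 * l2 * l3)
      + Const (1/432) * l1 *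
          (- 864 * l1 + l1^3 - 1728 * l2 + 24 * l1^2 * l2 - 26 * l1 * l2^2
           + 244 * l1 * l2 * l3))"


section \<open>The structure constants as polynomials in the parameters\<close>

definition c2 :: "par mpoly \<Rightarrow> par mpoly \<Rightarrow> par mpoly" where
  "c2 x y = Const (2/3) * (x^2 + y^2 + x * y) - 2"

definition c3 :: "par mpoly \<Rightarrow> par mpoly \<Rightarrow> par mpoly" where
  "c3 x y = Const (1/9) * (x + 2 * y - 3) * (2 * x + y + 3) * (x - y - 3)"

fun kl_values :: "kl \<Rightarrow> par mpoly" where
  "kl_values (K I1) = c2 m1 m2"
| "kl_values (K I2) = c2 m1' m2'"
| "kl_values (K I3) = c2 m1'' m2''"
| "kl_values (L I1) = c3 m1 m2 + Const (3/2) * c2 m1 m2"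
| "kl_values (L I2) = c3 m1' m2' + Const (3/2) * c2 m1' m2'"
| "kl_values (L I3) = - c3 m1'' m2'' - Const (3/2) * c2 m1'' m2''"

definition a2 :: "par mpoly" where "a2 = subst kl_values a2_kl"
definition a5 :: "par mpoly" where "a5 = subst kl_values a5_kl"
definition a6 :: "par mpoly" where "a6 = subst kl_values a6_kl"
definition a8 :: "par mpoly" where "a8 = subst kl_values a8_kl"
definition a9 :: "par mpoly" where "a9 = subst kl_values a9_kl"
definition a12 :: "par mpoly" where "a12 = subst kl_values a12_kl"


section \<open>The algebra \<open>Z\<^sub>2(sl(3))\<^sup>s\<^sup>p\<^sup>e\<^sup>c\<close>\<close>

datatype gen = GX | GY | GZ

abbreviation X :: "gen free_alg" where "X \<equiv> Gen GX"
abbreviation Y :: "gen free_alg" where "Y \<equiv> Gen GY"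
abbreviation Z :: "gen free_alg" where "Z \<equiv> Gen GZ"

definition commutator :: "gen free_alg \<Rightarrow> gen free_alg \<Rightarrow> gen free_alg" where
  "commutator u v = u * v - v * u"

definition anticommutator :: "gen free_alg \<Rightarrow> gen free_alg \<Rightarrow> gen free_alg" where
  "anticommutator u v = u * v + v * u"

text \<open>
  The defining relations, as pairs of a left and a right hand side. A constant on the right
  hand side of a relation stands for that multiple of the unit.
\<close>

definition Z2_relations :: "(par \<Rightarrow> complex) \<Rightarrow> (gen free_alg \<times> gen free_alg) list" where
  "Z2_relations \<mu> =
     (let b2 = peval \<mu> a2; b5 = peval \<mu> a5; b6 = peval \<mu> a6;
          b8 = peval \<mu> a8; b9 = peval \<mu> a9; b12 = peval \<mu> a12;
          x1 = 6 * b5 + 2 * b9;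
          x2 = - 2 * b6 - 2 * b8;
          x3 = 6 * b2 + b6;
          x4 = - b5;
          x5 = 8 * b2 - 24;
          x7 = - 2 * b2 + 12
      in [(commutator X Y, Z),
          (commutator X Z, - 6 * Y^2 + Const b2 * X^2 + Const b5 * X + Const b8),
          (commutator Y Z,
             - 2 * X^3 - Const b2 * anticommutator X Y - Const b5 * Y + Const b6 * X + Const b9),
          (Const x1 * X + Const x2 * Y + Const x3 * X^2 + Const x4 * anticommutator X Y
             + Const x5 * Y^2 + Const x7 * (X * Y * X) - X^4 + 4 * Y^3 + Z^2,
           Const b12)])"

definition Z2_spec :: "(par \<Rightarrow> complex) \<Rightarrow> gen free_alg set ring" where
  "Z2_spec \<mu> = presented_algebra (Z2_relations \<mu>)"

end

theory Submission
  imports Defs "HOL-Computational_Algebra.Polynomial"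
begin

text \<open>
  Write \<open>(m1, m2) = (x\<^sub>1 - x\<^sub>2, x\<^sub>2 - x\<^sub>3)\<close> with \<open>x\<^sub>1 + x\<^sub>2 + x\<^sub>3 = 0\<close>, and similarly \<open>y\<close> for \<open>(m1', m2')\<close> and
  \<open>z\<close> for \<open>(- m1'', - m2'')\<close>. With the elementary symmetric functions \<open>p = e\<^sub>2\<close> and \<open>q = e\<^sub>3\<close> of these
  triples, \<open>k\<^sub>i = - 2 p\<^sub>i - 2\<close> and \<open>l\<^sub>i = 3 q\<^sub>i\<close>, so the \<open>a\<^sub>i\<close> are polynomials in the six invariants \<open>p\<^sub>i, q\<^sub>i\<close> of
  the subgroup of type \<open>A\<^sub>2 \<times> A\<^sub>2 \<times> A\<^sub>2\<close>. Averaging over that subgroup also turns the monomials defining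
  \<open>p2, \<dots>, p12\<close> into such polynomials. A polynomial that \<open>s\<^sub>3\<close> negates has average \<open>0\<close> over \<open>W(E\<^sub>6)\<close>; averaging
  \<open>\<alpha>\<^sub>3 m1\<^bsup>2l\<^esup> m1'\<^bsup>2m\<^esup> m1''\<^bsup>2n\<^esup>\<close> and \<open>(y\<^sub>3 - z\<^sub>3)\<close> times it over the subgroup first gives relations in \<open>p\<^sub>i, q\<^sub>i\<close> that,
  together with the symmetry exchanging the three factors, reduce every required average to a
  polynomial in the power sums of the 27 weights, which are visibly invariant. What remains are
  identities between polynomials in six variables. The normalising factor \<open>51840\<close> is the order
  of the group, computed along a chain of stabilisers of weights.
\<close>

section \<open>Evaluation and substitution of polynomials\<close>

lemma monomial_add:
  fixes \<sigma> :: "'v \<Rightarrow> 'b::comm_ring_1" and m n :: "'v \<Rightarrow>\<^sub>0 nat"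
  shows "(\<Prod>v\<in>Poly_Mapping.keys (m + n). \<sigma> v ^ Poly_Mapping.lookup (m + n) v) =
    (\<Prod>v\<in>Poly_Mapping.keys m. \<sigma> v ^ Poly_Mapping.lookup m v) *
    (\<Prod>v\<in>Poly_Mapping.keys n. \<sigma> v ^ Poly_Mapping.lookup n v)"
proof -
  let ?M = "Poly_Mapping.keys m \<union> Poly_Mapping.keys n"
  have ext: "(\<Prod>v\<in>Poly_Mapping.keys k. \<sigma> v ^ Poly_Mapping.lookup k v) =
      (\<Prod>v\<in>?M. \<sigma> v ^ Poly_Mapping.lookup k v)" if "Poly_Mapping.keys k \<subseteq> ?M" for k
    using that by (intro prod.mono_neutral_left) (auto simp: in_keys_iff)
  show ?thesis
    unfolding ext[OF keys_add] ext[OF Un_upper1] ext[OF Un_upper2]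
    by (simp add: lookup_add power_add prod.distrib)
qed

text \<open>Covers both \<open>peval\<close>, which keeps scalars, and \<open>subst\<close>, which
  embeds them by \<open>Const\<close>.\<close>

locale scalar_hom =
  fixes \<phi> :: "complex \<Rightarrow> 'b::comm_ring_1"
  assumes hom_add: "\<phi> (a + b) = \<phi> a + \<phi> b"
    and hom_mult: "\<phi> (a * b) = \<phi> a * \<phi> b"
    and hom_one: "\<phi> 1 = 1"
begin

lemma hom_zero: "\<phi> 0 = 0"
  using hom_add[of 0 0] by simp

text \<open>Cancellation can make the support of a sum smaller than the union of the supports, so
  sums are compared over a common larger index set.\<close>

lemma insertion_superset:
  assumes "finite M" "Poly_Mapping.keys p \<subseteq> M"
  shows "insertion \<phi> \<sigma> p = (\<Sum>m\<in>M. \<phi> (Poly_Mapping.lookup p m) *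
           (\<Prod>v\<in>Poly_Mapping.keys m. \<sigma> v ^ Poly_Mapping.lookup m v))"
  unfolding insertion_def using assms
  by (intro sum.mono_neutral_left) (auto simp: in_keys_iff hom_zero)

lemma insertion_zero: "insertion \<phi> \<sigma> 0 = 0"
  by (simp add: insertion_def)

lemma insertion_single: "insertion \<phi> \<sigma> (Poly_Mapping.single m c) =
    \<phi> c * (\<Prod>v\<in>Poly_Mapping.keys m. \<sigma> v ^ Poly_Mapping.lookup m v)"
  by (subst insertion_superset[of "{m}"]) auto

lemma insertion_add: "insertion \<phi> \<sigma> (p + q) = insertion \<phi> \<sigma> p + insertion \<phi> \<sigma> q"
proof -
  let ?M = "Poly_Mapping.keys p \<union> Poly_Mapping.keys q"
  have "Poly_Mapping.keys (p + q) \<subseteq> ?M"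
    by (rule keys_add)
  then show ?thesis
    by (simp add: insertion_superset[of ?M] lookup_add hom_add distrib_right sum.distrib)
qed

lemma insertion_sum: "insertion \<phi> \<sigma> (\<Sum>i\<in>I. f i) = (\<Sum>i\<in>I. insertion \<phi> \<sigma> (f i))"
  by (induction I rule: infinite_finite_induct) (simp_all add: insertion_zero insertion_add)

lemma insertion_mult: "insertion \<phi> \<sigma> (p * q) = insertion \<phi> \<sigma> p * insertion \<phi> \<sigma> q"
proof -
  have expand: "p = (\<Sum>m\<in>Poly_Mapping.keys p. Poly_Mapping.single m (Poly_Mapping.lookup p m))"
    for p :: "'v mpoly"
    by (rule poly_mapping_eqI) (simp add: lookup_sum lookup_single when_def in_keys_iff)
  show ?thesis
    by (subst (1 2) expand[of p], subst (1 2) expand[of q])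
      (simp add: sum_product mult_single insertion_sum insertion_single monomial_add
        hom_mult ac_simps)
qed

lemma insertion_Const: "insertion \<phi> \<sigma> (Const c) = \<phi> c"
  by (simp add: Const_def insertion_single)

lemma insertion_Var: "insertion \<phi> \<sigma> (Var v) = \<sigma> v"
  by (simp add: Var_def insertion_single hom_one)

lemma insertion_one: "insertion \<phi> \<sigma> 1 = 1"
  using insertion_Const[of \<sigma> 1] by (simp add: Const_def hom_one)

lemma insertion_uminus: "insertion \<phi> \<sigma> (- p) = - insertion \<phi> \<sigma> p"
  using insertion_add[of \<sigma> p "- p"] by (simp add: insertion_zero eq_neg_iff_add_eq_0 add.commute)

lemma insertion_diff: "insertion \<phi> \<sigma> (p - q) = insertion \<phi> \<sigma> p - insertion \<phi> \<sigma> q"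
  using insertion_add[of \<sigma> p "- q"] by (simp add: insertion_uminus)

lemma insertion_power: "insertion \<phi> \<sigma> (p ^ n) = insertion \<phi> \<sigma> p ^ n"
  by (induction n) (simp_all add: insertion_one insertion_mult)

lemma insertion_prod: "insertion \<phi> \<sigma> (\<Prod>i\<in>I. f i) = (\<Prod>i\<in>I. insertion \<phi> \<sigma> (f i))"
  by (induction I rule: infinite_finite_induct) (simp_all add: insertion_one insertion_mult)

lemma insertion_of_nat: "insertion \<phi> \<sigma> (of_nat n) = of_nat n"
  by (induction n) (simp_all add: insertion_zero insertion_one insertion_add)

lemma insertion_of_int: "insertion \<phi> \<sigma> (of_int n) = of_int n"
  by (cases n) (simp_all add: insertion_of_nat insertion_uminus insertion_diff insertion_one)

lemma insertion_numeral: "insertion \<phi> \<sigma> (numeral n) = numeral n"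
  using insertion_of_nat[of \<sigma> "numeral n"] by simp

lemmas insertion_simps = insertion_zero insertion_one insertion_add insertion_mult insertion_Const
  insertion_Var insertion_uminus insertion_diff insertion_power insertion_numeral insertion_sum
  insertion_prod insertion_of_int

end

interpretation scalar_id: scalar_hom "\<lambda>c. c"
  by unfold_locales simp_all

interpretation scalar_Const: scalar_hom Const
  by unfold_locales (simp_all add: Const_def single_add mult_single)

lemmas peval_simps = scalar_id.insertion_simps[folded peval_def]

text \<open>Turns substitution into a change of the evaluation point, so that the group can be
  studied on points instead of polynomials.\<close>

lemma peval_subst: "peval \<mu> (subst \<sigma> p) = peval (\<lambda>v. peval \<mu> (\<sigma> v)) p"
  unfolding subst_def insertion_def[of Const] peval_simps
  by (simp add: peval_def insertion_def)

lemma digit_expansion_unique: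
  fixes a a' B c c' :: nat
  assumes "a < B" "a' < B" "a + B * c = a' + B * c'"
  shows "a = a'" "c = c'"
proof -
  show "a = a'"
    using arg_cong[OF assms(3), of "\<lambda>n. n mod B"] assms(1,2) by simp
  then show "c = c'"
    using assms by simp
qed

text \<open>Kronecker substitution: base-\<open>B\<close> digits separate the finitely many monomials of a polynomial.\<close>

lemma peval_eqI:
  fixes f g :: "par mpoly"
  assumes "\<And>\<mu>. peval \<mu> f = peval \<mu> g"
  shows "f = g"
proof -
  define p where "p = f - g"
  have zero: "peval \<mu> p = 0" for \<mu>
    using assms by (simp add: p_def peval_simps)
  \<comment> \<open>One more than the total of all exponents exceeds each of them, so the exponents
    are base-\<open>B\<close> digits.\<close>
  define B where "B = Suc (\<Sum>m\<in>Poly_Mapping.keys p. \<Sum>v\<in>Poly_Mapping.keys m. Poly_Mapping.lookup m v)"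
  have digit: "Poly_Mapping.lookup m v < B" if "m \<in> Poly_Mapping.keys p" for m v
  proof (cases "v \<in> Poly_Mapping.keys m")
    case True
    then have "Poly_Mapping.lookup m v \<le> (\<Sum>v\<in>Poly_Mapping.keys m. Poly_Mapping.lookup m v)"
      by (intro member_le_sum) auto
    also have "\<dots> \<le> (\<Sum>m\<in>Poly_Mapping.keys p. \<Sum>v\<in>Poly_Mapping.keys m. Poly_Mapping.lookup m v)"
      using that by (intro member_le_sum[of m _ "\<lambda>m. \<Sum>v\<in>Poly_Mapping.keys m. Poly_Mapping.lookup m v"]) auto
    finally show ?thesis by (simp add: B_def)
  qed (simp add: B_def in_keys_iff)
  define pos :: "par \<Rightarrow> nat" where
    "pos v = (case v of M1 \<Rightarrow> 0 | M2 \<Rightarrow> 1 | M1' \<Rightarrow> 2 | M2' \<Rightarrow> 3 | M1'' \<Rightarrow> 4 | M2'' \<Rightarrow> 5)" for v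
  have par_UNIV: "UNIV = {M1, M2, M1', M2', M1'', M2''}"
    using par.exhaust by blast
  have fin: "finite (UNIV :: par set)"
    by (subst par_UNIV) simp
  define code :: "(par \<Rightarrow>\<^sub>0 nat) \<Rightarrow> nat" where
    "code m = (\<Sum>v\<in>UNIV. Poly_Mapping.lookup m v * B ^ pos v)" for m
  have code_Horner: "code m = Poly_Mapping.lookup m M1 + B * (Poly_Mapping.lookup m M2
      + B * (Poly_Mapping.lookup m M1' + B * (Poly_Mapping.lookup m M2'
      + B * (Poly_Mapping.lookup m M1'' + B * (Poly_Mapping.lookup m M2'')))))" for m
    unfolding code_def par_UNIV by (simp add: pos_def eval_nat_numeral algebra_simps)
  have inj: "inj_on code (Poly_Mapping.keys p)"
  proof (rule inj_onI)
    fix m n assume mn: "m \<in> Poly_Mapping.keys p" "n \<in> Poly_Mapping.keys p" "code m = code n"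
    note d = digit[OF mn(1)] digit[OF mn(2)]
    note e1 = digit_expansion_unique[OF d(1) d(2) mn(3)[unfolded code_Horner]]
    note e2 = digit_expansion_unique[OF d(1) d(2) e1(2)]
    note e3 = digit_expansion_unique[OF d(1) d(2) e2(2)]
    note e4 = digit_expansion_unique[OF d(1) d(2) e3(2)]
    note e5 = digit_expansion_unique[OF d(1) d(2) e4(2)]
    show "m = n"
    proof (rule poly_mapping_eqI)
      fix v show "Poly_Mapping.lookup m v = Poly_Mapping.lookup n v"
        using e1(1) e2(1) e3(1) e4(1) e5 by (cases v) simp_all
    qed
  qed
  define u where "u = (\<Sum>m\<in>Poly_Mapping.keys p. monom (Poly_Mapping.lookup p m) (code m))"
  have "poly u t = 0" for t
  proof -
    have "poly u t = peval (\<lambda>v. t ^ (B ^ pos v)) p"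
    proof -
      have "(\<Prod>v\<in>Poly_Mapping.keys m. (t ^ (B ^ pos v)) ^ Poly_Mapping.lookup m v) = t ^ code m" for m
      proof -
        have "(\<Prod>v\<in>Poly_Mapping.keys m. (t ^ (B ^ pos v)) ^ Poly_Mapping.lookup m v)
            = (\<Prod>v\<in>UNIV. (t ^ (B ^ pos v)) ^ Poly_Mapping.lookup m v)"
          using fin by (intro prod.mono_neutral_left) (auto simp: in_keys_iff)
        then show ?thesis
          by (simp add: code_def power_sum mult.commute flip: power_mult)
      qed
      then show ?thesis
        by (simp add: u_def peval_def insertion_def poly_sum poly_monom)
    qed
    then show ?thesis using zero by simp
  qed
  then have "u = 0"
    using poly_all_0_iff_0 by blast
  have "Poly_Mapping.keys p = {}"
  proof (rule ccontr)
    assume "Poly_Mapping.keys p \<noteq> {}"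
    then obtain m where m: "m \<in> Poly_Mapping.keys p" by blast
    \<comment> \<open>By injectivity of \<open>code\<close>, no other monomial contributes to this
      coefficient.\<close>
    have "coeff u (code m) = (\<Sum>n\<in>Poly_Mapping.keys p. if n = m then Poly_Mapping.lookup p n else 0)"
      unfolding u_def coeff_sum
      using inj m by (intro sum.cong) (auto dest: inj_onD)
    then have "coeff u (code m) = Poly_Mapping.lookup p m"
      using m by simp
    with \<open>u = 0\<close> m show False
      by (simp add: in_keys_iff)
  qed
  then show ?thesis
    by (simp add: p_def)
qed

section \<open>The Weyl group as a group of transformations of the parameter space\<close>

type_synonym point = "par \<Rightarrow> complex"

definition alpha3 :: "point \<Rightarrow> complex" where
  "alpha3 \<mu> = ((\<mu> M1'' + 2 * \<mu> M2'') - (\<mu> M1 + 2 * \<mu> M2) - (\<mu> M1' + 2 * \<mu> M2')) / 3"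

text \<open>Any number outside 1 to 5 acts as the sixth reflection, so
  \<open>reflect_involution\<close> holds without a range assumption.\<close>

definition reflect :: "nat \<Rightarrow> point \<Rightarrow> point" where
  "reflect s \<mu> =
    (if s = 1 then \<mu>(M1 := - \<mu> M1, M2 := \<mu> M1 + \<mu> M2)
     else if s = 2 then \<mu>(M1 := \<mu> M1 + \<mu> M2, M2 := - \<mu> M2)
     else if s = 3 then \<mu>(M2 := \<mu> M2 + alpha3 \<mu>, M2' := \<mu> M2' + alpha3 \<mu>, M2'' := \<mu> M2'' - alpha3 \<mu>)
     else if s = 4 then \<mu>(M1' := \<mu> M1' + \<mu> M2', M2' := - \<mu> M2')
     else if s = 5 then \<mu>(M1' := - \<mu> M1', M2' := \<mu> M1' + \<mu> M2')
     else \<mu>(M1'' := \<mu> M1'' + \<mu> M2'', M2'' := - \<mu> M2''))"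

lemma reflect_simps:
  "reflect 1 \<mu> = \<mu>(M1 := - \<mu> M1, M2 := \<mu> M1 + \<mu> M2)"
  "reflect 2 \<mu> = \<mu>(M1 := \<mu> M1 + \<mu> M2, M2 := - \<mu> M2)"
  "reflect 3 \<mu> = \<mu>(M2 := \<mu> M2 + alpha3 \<mu>, M2' := \<mu> M2' + alpha3 \<mu>, M2'' := \<mu> M2'' - alpha3 \<mu>)"
  "reflect 4 \<mu> = \<mu>(M1' := \<mu> M1' + \<mu> M2', M2' := - \<mu> M2')"
  "reflect 5 \<mu> = \<mu>(M1' := - \<mu> M1', M2' := \<mu> M1' + \<mu> M2')"
  "reflect 6 \<mu> = \<mu>(M1'' := \<mu> M1'' + \<mu> M2'', M2'' := - \<mu> M2'')"
  by (simp_all add: reflect_def)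

lemma reflect_involution: "reflect s (reflect s \<mu>) = \<mu>"
  by (rule ext, rename_tac v, case_tac v) (simp_all add: reflect_def alpha3_def field_simps)

primrec walk :: "nat list \<Rightarrow> point \<Rightarrow> point" where
  "walk [] = id"
| "walk (s # w) = reflect s \<circ> walk w"

lemma walk_append: "walk (v @ w) = walk v \<circ> walk w"
  by (induction v) (simp_all add: comp_assoc)

lemma walk_rev: "walk w (walk (rev w) \<mu>) = \<mu>" "walk (rev w) (walk w \<mu>) = \<mu>"
proof -
  have "walk w (walk (rev w) \<mu>) = \<mu>" for w \<mu>
    by (induction w arbitrary: \<mu>) (simp_all add: walk_append reflect_involution)
  from this[of w] this[of "rev w"] show "walk w (walk (rev w) \<mu>) = \<mu>" "walk (rev w) (walk w \<mu>) = \<mu>"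
    by simp_all
qed

lemma transform_generators:
  "transform s1 = reflect 1" "transform s2 = reflect 2" "transform s3 = reflect 3"
  "transform s4 = reflect 4" "transform s5 = reflect 5" "transform s6 = reflect 6"
  by (intro ext; rename_tac v; case_tac v;
      simp add: transform_def s1_def s2_def s3_def s4_def s5_def s6_def peval_subst
        reflect_simps[unfolded One_nat_def] alpha3_def \<alpha>\<^sub>3_def peval_simps)+

lemma transform_id: "transform (\<lambda>f. f) = (\<lambda>\<mu>. \<mu>)"
  by (rule ext) (simp add: transform_def peval_simps)

lemma peval_generator:
  assumes "s \<in> {s1, s2, s3, s4, s5, s6}"
  shows "peval \<mu> (s f) = peval (transform s \<mu>) f"
proof -
  have "peval \<mu> (subst \<sigma> f) = peval (transform (subst \<sigma>) \<mu>) f" for \<sigma>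
    by (simp add: transform_def peval_subst peval_simps)
  with assms show ?thesis
    unfolding s1_def s2_def s3_def s4_def s5_def s6_def by auto
qed

lemma peval_W: "w \<in> W_E6 \<Longrightarrow> peval \<mu> (w f) = peval (transform w \<mu>) f"
proof (induction arbitrary: \<mu> rule: W_E6.induct)
  case W_E6_id
  show ?case by (simp add: id_def transform_id)
next
  case (W_E6_step s w)
  have "transform (s \<circ> w) \<mu> = transform w (transform s \<mu>)"
    by (simp add: transform_def[of "s \<circ> w"] transform_def[of w] peval_generator[OF W_E6_step(1)])
  with W_E6_step show ?case
    unfolding comp_apply[of s w] peval_generator[OF W_E6_step(1)] by simp
qed

text \<open>Automorphisms of the polynomials act contravariantly on points, so composition is
  reversed.\<close>

lemma transform_comp:
  assumes "v \<in> W_E6"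
  shows "transform (v \<circ> w) \<mu> = transform w (transform v \<mu>)"
  by (rule ext) (simp only: transform_def[of "v \<circ> w"] transform_def[of w] comp_apply peval_W[OF assms])

definition WT :: "(point \<Rightarrow> point) set" where
  "WT = walk ` lists {1..6}"

lemma generators_in_W: "{s1, s2, s3, s4, s5, s6} \<subseteq> W_E6"
  using W_E6_step[OF _ W_E6_id] by auto

lemma transform_W: "transform ` W_E6 = WT"
proof
  show "transform ` W_E6 \<subseteq> WT"
  proof
    fix t assume "t \<in> transform ` W_E6"
    then obtain w where "w \<in> W_E6" "t = transform w" by blast
    then show "t \<in> WT"
    proof (induction arbitrary: t rule: W_E6.induct)
      case W_E6_id
      then show ?case
        unfolding WT_def by (intro image_eqI[of _ _ "[]"]) (auto simp: id_def transform_id)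
    next
      case (W_E6_step s w)
      obtain u where u: "set u \<subseteq> {1..6}" "transform w = walk u"
        using W_E6_step.IH by (auto simp: WT_def lists_eq_set)
      have "transform s \<in> reflect ` {1, 2, 3, 4, 5, 6}"
        using W_E6_step(1) transform_generators by (elim insertE) simp_all
      moreover have "{1, 2, 3, 4, 5, 6} = {1..6 :: nat}"
        by auto
      ultimately obtain k where k: "k \<in> {1..6}" "transform s = reflect k"
        by (metis imageE)
      \<comment> \<open>Because \<open>transform\<close> reverses composition, the new generator
        goes to the end of the word.\<close>
      have "transform (s \<circ> w) = walk (u @ [k])"
        using transform_comp[OF subsetD[OF generators_in_W W_E6_step(1)]] u(2) k(2)
        by (simp add: fun_eq_iff walk_append)
      with W_E6_step.prems have "t = walk (u @ [k])"
        by (simp only:)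
      then show ?case
        unfolding WT_def using u(1) k(1)
        by (intro image_eqI[of _ _ "u @ [k]"]) (simp_all add: lists_eq_set)
    qed
  qed
  show "WT \<subseteq> transform ` W_E6"
  proof
    fix t assume "t \<in> WT"
    then obtain u where "set u \<subseteq> {1..6}" "t = walk u"
      by (auto simp: WT_def lists_eq_set)
    then show "t \<in> transform ` W_E6"
    proof (induction u arbitrary: t rule: rev_induct)
      case Nil
      then show ?case
        using W_E6_id by (intro image_eqI[of _ _ id]) (auto simp: id_def transform_id)
    next
      case (snoc k u)
      then obtain w where w: "w \<in> W_E6" "transform w = walk u"
        by fastforce
      have "k = 1 \<or> k = 2 \<or> k = 3 \<or> k = 4 \<or> k = 5 \<or> k = 6"
        using snoc.prems by auto
      then obtain s where s: "s \<in> {s1, s2, s3, s4, s5, s6}" "transform s = reflect k"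
        using transform_generators by blast
      have "t = transform (s \<circ> w)"
        using snoc.prems(2) transform_comp[OF subsetD[OF generators_in_W s(1)]] s(2) w(2)
        by (simp add: fun_eq_iff walk_append)
      then show ?case
        using W_E6.W_E6_step[OF s(1) w(1)] by blast
    qed
  qed
qed

text \<open>A polynomial is determined by its values. Hence sums over \<open>W_E6\<close> can be
  replaced by sums over \<open>WT\<close>.\<close>

lemma inj_on_transform: "inj_on transform W_E6"
proof (rule inj_onI)
  fix v w assume "v \<in> W_E6" "w \<in> W_E6" "transform v = transform w"
  then have "peval \<mu> (v f) = peval \<mu> (w f)" for \<mu> f
    by (simp add: peval_W)
  then show "v = w"
    by (intro ext peval_eqI)
qed

section \<open>The 27 weights and the order of the Weyl group\<close>

text \<open>
  A pair of Dynkin labels \<open>(a, b)\<close> of \<open>sl(3)\<close> is encoded by the three numbers with sum \<open>0\<close> and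
  successive differences \<open>a\<close>, \<open>b\<close>. With \<open>x, y, z\<close> the triples of \<open>(m1, m2)\<close>, \<open>(m1', m2')\<close>,
  \<open>(- m1'', - m2'')\<close>, the 27 weights of the minuscule representation of \<open>E\<^sub>6\<close> are the differences
  \<open>x\<^sub>i - y\<^sub>j\<close>, \<open>y\<^sub>i - z\<^sub>j\<close>, \<open>z\<^sub>i - x\<^sub>j\<close>, and \<open>\<alpha>\<^sub>3 = x\<^sub>3 + y\<^sub>3 + z\<^sub>3\<close>.
\<close>

definition triple :: "complex \<Rightarrow> complex \<Rightarrow> complex list" where
  "triple a b = [(2 * a + b) / 3, (b - a) / 3, - ((a + 2 * b) / 3)]"

definition differences :: "complex list \<Rightarrow> complex list \<Rightarrow> complex list" where
  "differences xs ys = concat (map (\<lambda>u. map (\<lambda>v. u - v) ys) xs)"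

definition weights :: "point \<Rightarrow> complex list" where
  "weights \<mu> = (let x = triple (\<mu> M1) (\<mu> M2); y = triple (\<mu> M1') (\<mu> M2');
                    z = triple (- \<mu> M1'') (- \<mu> M2'')
                in differences x y @ differences y z @ differences z x)"

definition weight :: "nat \<Rightarrow> point \<Rightarrow> complex" where
  "weight i \<mu> = weights \<mu> ! i"

definition indices :: "nat list" where
  "indices = [0, 1, 2, 3, 4, 5, 6, 7, 8, 9, 10, 11, 12, 13, 14, 15, 16, 17, 18, 19, 20, 21, 22, 23, 24, 25, 26]"

text \<open>Row \<open>s - 1\<close> belongs to the reflection \<open>s\<close>; weights are numbered by their position in \<^const>\<open>weights\<close>.\<close>

definition perm_table :: "nat list list" where
  "perm_table = [
    [3, 4, 5, 0, 1, 2, 6, 7, 8, 9, 10, 11, 12, 13, 14, 15, 16, 17, 19, 18, 20, 22, 21, 23, 25, 24, 26],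
    [0, 1, 2, 6, 7, 8, 3, 4, 5, 9, 10, 11, 12, 13, 14, 15, 16, 17, 18, 20, 19, 21, 23, 22, 24, 26, 25],
    [0, 1, 25, 3, 4, 24, 14, 11, 8, 9, 10, 7, 12, 13, 6, 23, 20, 17, 18, 19, 16, 21, 22, 15, 5, 2, 26],
    [0, 2, 1, 3, 5, 4, 6, 8, 7, 9, 10, 11, 15, 16, 17, 12, 13, 14, 18, 19, 20, 21, 22, 23, 24, 25, 26],
    [1, 0, 2, 4, 3, 5, 7, 6, 8, 12, 13, 14, 9, 10, 11, 15, 16, 17, 18, 19, 20, 21, 22, 23, 24, 25, 26],
    [0, 1, 2, 3, 4, 5, 6, 7, 8, 9, 11, 10, 12, 14, 13, 15, 17, 16, 18, 19, 20, 24, 25, 26, 21, 22, 23]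
  ]"

definition perm :: "nat \<Rightarrow> nat \<Rightarrow> nat" where
  "perm s i = perm_table ! (s - 1) ! i"

text \<open>Comparing the lists entry by entry gives one rewrite rule for each of the 162 values of
  \<open>perm\<close>.\<close>

lemma perm_values: "map (\<lambda>s. map (perm s) indices) [1, 2, 3, 4, 5, 6] = perm_table"
  by (simp add: perm_def perm_table_def indices_def)

lemmas perm_simps = perm_values[unfolded perm_table_def indices_def, simplified]

lemma weight_values: "map (\<lambda>i. weight i \<mu>) indices = weights \<mu>"
  by (simp add: weight_def indices_def weights_def differences_def triple_def Let_def)

lemmas weight_simps = weight_values[unfolded indices_def weights_def differences_def triple_def Let_def,
    simplified]

lemma indices_eq: "indices = [0..<27]"
  by (simp add: indices_def upt_conv_Cons)

lemma perm_closed: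
  assumes "s \<in> {1..6}" "i \<in> set indices"
  shows "perm s i \<in> set indices"
proof -
  have "list_all (\<lambda>s. list_all (\<lambda>i. perm s i < 27) indices) [1, 2, 3, 4, 5, 6]"
    unfolding indices_def by (simp add: perm_simps)
  moreover have "s \<in> set [1, 2, 3, 4, 5, 6]"
    using assms(1) by auto
  ultimately show ?thesis
    using assms(2) by (auto simp: list_all_iff indices_eq)
qed

text \<open>Certifies the table: for each reflection and each weight this is a linear identity in
  the parameters.\<close>

lemma weight_reflect:
  assumes "s \<in> {1..6}" "i \<in> set indices"
  shows "weight i (reflect s \<mu>) = weight (perm s i) \<mu>"
proof -
  have "s = 1 \<or> s = 2 \<or> s = 3 \<or> s = 4 \<or> s = 5 \<or> s = 6"
    using assms(1) by auto
  with assms(2) show ?thesis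
    unfolding indices_def
    by (elim disjE; simp only: reflect_simps)
      (simp; elim disjE; simp add: perm_simps weight_simps alpha3_def field_simps)+
qed

text \<open>The first letter acts first here, but last in \<open>walk\<close>: pulling a weight back
  along a composite removes the outermost reflection first.\<close>

primrec track :: "nat list \<Rightarrow> nat \<Rightarrow> nat" where
  "track [] i = i"
| "track (s # w) i = track w (perm s i)"

lemma weight_walk:
  assumes "set w \<subseteq> {1..6}" "i \<in> set indices"
  shows "track w i \<in> set indices" "weight i (walk w \<mu>) = weight (track w i) \<mu>"
  using assms
  by (induction w arbitrary: i) (simp_all add: perm_closed weight_reflect)

lemma weight_inject:
  assumes "i \<in> set indices" "j \<in> set indices" "weight i = weight j"
  shows "i = j"
proof -
  \<comment> \<open>A point at which the 27 weights take pairwise different values.\<close>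
  define \<mu> :: point where
    "\<mu> v = (case v of M1 \<Rightarrow> - 12 | M2 \<Rightarrow> 39 | M1' \<Rightarrow> 139 | M2' \<Rightarrow> 25
       | M1'' \<Rightarrow> - 709 | M2'' \<Rightarrow> - 1609)" for v
  have "distinct (map (\<lambda>i. weight i \<mu>) indices)"
    unfolding indices_def by (simp add: weight_simps \<mu>_def)
  then have "inj_on (\<lambda>i. weight i \<mu>) (set indices)"
    by (simp only: distinct_map)
  then show ?thesis
    by (rule inj_onD) (simp_all add: assms)
qed

text \<open>Six weights that span the dual of the parameter space.\<close>

definition probes :: "nat list" where
  "probes = [0, 1, 3, 6, 9, 10]"

text \<open>As the \<open>x\<close> triple sums to zero, weights 0, 3 and 6 add up to
  \<open>-3\<close> times the first entry of the \<open>y\<close> triple. Every other entry that is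
  needed then follows from a single weight.\<close>

lemma point_from_weights:
  "\<mu> M1 = weight 0 \<mu> - weight 3 \<mu>"
  "\<mu> M2 = weight 3 \<mu> - weight 6 \<mu>"
  "\<mu> M1' = weight 1 \<mu> - weight 0 \<mu>"
  "\<mu> M2' = - weight 0 \<mu> - weight 3 \<mu> - weight 6 \<mu> - 2 * (weight 1 \<mu> - weight 0 \<mu>)"
  "\<mu> M1'' = weight 9 \<mu> - weight 10 \<mu>"
  "\<mu> M2'' = 3 * weight 9 \<mu> + weight 0 \<mu> + weight 3 \<mu> + weight 6 \<mu> - 2 * (weight 9 \<mu> - weight 10 \<mu>)"
  by (simp_all add: weight_simps field_simps)

lemma point_eqI:
  assumes "\<And>i. i \<in> set probes \<Longrightarrow> weight i \<mu> = weight i \<nu>"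
  shows "\<mu> = \<nu>"
proof
  have e: "weight 0 \<mu> = weight 0 \<nu>" "weight 1 \<mu> = weight 1 \<nu>" "weight 3 \<mu> = weight 3 \<nu>"
    "weight 6 \<mu> = weight 6 \<nu>" "weight 9 \<mu> = weight 9 \<nu>" "weight 10 \<mu> = weight 10 \<nu>"
    using assms by (simp_all add: probes_def)
  fix v show "\<mu> v = \<nu> v"
    by (cases v) (simp_all only: point_from_weights e)
qed

text \<open>Reduces equality of two group elements to a finite computation with six indices.\<close>

lemma walk_eqI:
  assumes "set v \<subseteq> {1..6}" "set w \<subseteq> {1..6}" "map (track v) probes = map (track w) probes"
  shows "walk v = walk w"
proof
  fix \<mu>
  have "set probes \<subseteq> set indices"
    by (auto simp: probes_def indices_def)
  with assms show "walk v \<mu> = walk w \<mu>"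
    by (intro point_eqI) (auto simp: weight_walk(2))
qed

text \<open>
  A transversal lists, for each weight in the orbit of \<open>b\<close> under the group generated by \<open>J\<close>, a
  word that moves \<open>b\<close> there. The last conjunct is the deletion property of minimal coset
  representatives of a parabolic subgroup.
\<close>

definition coset_step ::
  "nat list \<Rightarrow> (nat \<Rightarrow> nat list option) \<Rightarrow> nat \<times> nat list \<Rightarrow> nat \<Rightarrow> bool" where
  "coset_step J' rep jc s \<longleftrightarrow>
     (case rep (perm s (fst jc)) of None \<Rightarrow> False
      | Some c \<Rightarrow> list_ex (\<lambda>t. map (track (snd jc @ [s])) probes = map (track (t @ c)) probes)
          ([] # map (\<lambda>s. [s]) J'))"

text \<open>
  The quantified function \<open>rep\<close> stands for \<^term>\<open>map_of cs\<close>; it keeps the list \<open>cs\<close> out of the terms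
  to be simplified.
\<close>

definition transversal :: "nat list \<Rightarrow> nat list \<Rightarrow> nat \<Rightarrow> (nat \<times> nat list) list \<Rightarrow> bool" where
  "transversal J J' b cs \<longleftrightarrow>
     set J' \<subseteq> set J \<and> set J \<subseteq> {1..6} \<and> b \<in> set indices \<and> (b, []) \<in> set cs \<and> distinct (map fst cs) \<and>
     list_all (\<lambda>jc. set (snd jc) \<subseteq> set J \<and> track (snd jc) b = fst jc) cs \<and>
     list_all (\<lambda>s. perm s b = b) J' \<and>
     (\<forall>rep. list_all (\<lambda>jc. rep (fst jc) = Some (snd jc)) cs \<longrightarrow>
        list_all (\<lambda>jc. list_all (coset_step J' rep jc) J) cs)"

text \<open>An orbit-stabiliser count: each element of the group of \<open>J\<close> factors
  uniquely as an element of the group of \<open>J'\<close> after a listed representative. Existence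
  comes from the exchange property in \<open>coset_step\<close>, uniqueness from the image of
  \<open>b\<close>.\<close>

lemma card_transversal:
  assumes "transversal J J' b cs" and "length cs = n"
  shows "card (walk ` lists (set J)) = n * card (walk ` lists (set J'))"
proof -
  note unfolded = assms(1)[unfolded transversal_def list_all_iff]
  have J: "set J' \<subseteq> set J" "set J \<subseteq> {1..6}" and b: "b \<in> set indices" "(b, []) \<in> set cs"
    and dist: "distinct (map fst cs)"
    using unfolded by blast+
  have word: "set c \<subseteq> set J \<and> track c b = j" if "(j, c) \<in> set cs" for j c
    using unfolded that by (metis fst_conv snd_conv)
  have fixed: "perm s b = b" if "s \<in> set J'" for s
    using unfolded that by blast
  have "\<forall>jc\<in>set cs. map_of cs (fst jc) = Some (snd jc)"
    using dist by simp
  then have step: "coset_step J' (map_of cs) jc s" if "jc \<in> set cs" "s \<in> set J" for jc s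
    using unfolded that by blast
  \<comment> \<open>A letter passes a representative at the cost of at most one letter of
    \<open>J'\<close> on the left. Iterating this gives the factorisation of arbitrary
    words.\<close>
  have swap: "\<exists>c' t. c' \<in> snd ` set cs \<and> set t \<subseteq> set J' \<and> walk c \<circ> reflect s = walk t \<circ> walk c'"
    if cs: "c \<in> snd ` set cs" "s \<in> set J" for c s
  proof -
    obtain j where j: "(j, c) \<in> set cs"
      using cs(1) by auto
    obtain c' where c': "map_of cs (perm s j) = Some c'"
      and ex: "list_ex (\<lambda>t. map (track (c @ [s])) probes = map (track (t @ c')) probes)
           ([] # map (\<lambda>s. [s]) J')"
      using step[OF j cs(2)] unfolding coset_step_def fst_conv snd_conv
      by (cases "map_of cs (perm s j)") (simp_all only: option.case)
    then obtain t where t: "t \<in> set ([] # map (\<lambda>s. [s]) J')"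
      and eq: "map (track (c @ [s])) probes = map (track (t @ c')) probes"
      unfolding list_ex_iff by blast
    have c'_mem: "(perm s j, c') \<in> set cs"
      using c' by (rule map_of_SomeD)
    have t_sub: "set t \<subseteq> set J'"
      using t by auto
    have "walk (c @ [s]) = walk (t @ c')"
      using word[OF j] word[OF c'_mem] t_sub J cs(2) by (intro walk_eqI eq) auto
    then have "walk c \<circ> reflect s = walk t \<circ> walk c'"
      by (simp add: walk_append fun_eq_iff)
    with c'_mem t_sub show ?thesis
      by (intro exI[of _ c'] exI[of _ t]) force
  qed
  have decompose: "\<exists>c t. c \<in> snd ` set cs \<and> set t \<subseteq> set J' \<and> walk w = walk t \<circ> walk c"
    if "set w \<subseteq> set J" for w
    using that
  proof (induction w rule: rev_induct)
    case Nil
    show ?case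
      using b(2) by (intro exI[of _ "[]"]) force
  next
    case (snoc s w)
    have "set w \<subseteq> set J" "s \<in> set J"
      using snoc.prems by simp_all
    then obtain c t where ct: "c \<in> snd ` set cs" "set t \<subseteq> set J'" "walk w = walk t \<circ> walk c"
      using snoc.IH by blast
    moreover obtain c' t' where c't': "c' \<in> snd ` set cs" "set t' \<subseteq> set J'"
        "walk c \<circ> reflect s = walk t' \<circ> walk c'"
      using swap[OF ct(1) \<open>s \<in> set J\<close>] by blast
    ultimately have "walk (w @ [s]) = walk (t @ t') \<circ> walk c'"
      by (simp add: walk_append comp_assoc)
    with ct c't' show ?case
      by (intro exI[of _ c'] exI[of _ "t @ t'"]) auto
  qed
  have weight_fixed: "weight b (walk t \<mu>) = weight b \<mu>" if "set t \<subseteq> set J'" for t \<mu>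
  proof -
    have "track t b = b"
      using that by (induction t) (simp_all add: fixed)
    then show ?thesis
      using weight_walk(2)[of t b \<mu>] that J b(1) by auto
  qed
  let ?f = "\<lambda>(g, c). g \<circ> walk c"
  have "bij_betw ?f (walk ` lists (set J') \<times> snd ` set cs) (walk ` lists (set J))"
  proof (rule bij_betwI')
    fix gc hd assume gc: "gc \<in> walk ` lists (set J') \<times> snd ` set cs"
      and hd: "hd \<in> walk ` lists (set J') \<times> snd ` set cs"
    obtain t c where t: "gc = (walk t, c)" "set t \<subseteq> set J'" "c \<in> snd ` set cs"
      using gc by (auto simp: lists_eq_set)
    obtain u d where u: "hd = (walk u, d)" "set u \<subseteq> set J'" "d \<in> snd ` set cs"
      using hd by (auto simp: lists_eq_set)
    show "(?f gc = ?f hd) = (gc = hd)"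
    proof
      assume eq: "?f gc = ?f hd"
      have sub: "set c \<subseteq> {1..6}" "set d \<subseteq> {1..6}"
        using t(3) u(3) word J(2) by fastforce+
      \<comment> \<open>The left factors fix \<open>weight b\<close>, so equal products send
        \<open>b\<close> to the same weight, and that weight determines the representative.\<close>
      have "weight (track c b) = weight (track d b)"
      proof
        fix \<mu>
        have "walk t (walk c \<mu>) = walk u (walk d \<mu>)"
          using eq t(1) u(1) by (simp add: fun_eq_iff)
        then have "weight b (walk c \<mu>) = weight b (walk d \<mu>)"
          using weight_fixed[OF t(2), of "walk c \<mu>"] weight_fixed[OF u(2), of "walk d \<mu>"] by simp
        then show "weight (track c b) \<mu> = weight (track d b) \<mu>"
          using weight_walk(2)[OF sub(1) b(1)] weight_walk(2)[OF sub(2) b(1)] by simp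
      qed
      then have "track c b = track d b"
        using weight_inject weight_walk(1)[OF sub(1) b(1)] weight_walk(1)[OF sub(2) b(1)] by blast
      then have "c = d"
        using t(3) u(3) word eq_key_imp_eq_value[OF dist] by fastforce
      moreover have "walk t = walk u"
      proof
        fix \<mu>
        \<comment> \<open>Evaluating at the preimage under \<open>walk c\<close> cancels the common
          representative.\<close>
        have "(walk t \<circ> walk c) (walk (rev c) \<mu>) = (walk u \<circ> walk c) (walk (rev c) \<mu>)"
          using eq t(1) u(1) \<open>c = d\<close> by simp
        then show "walk t \<mu> = walk u \<mu>"
          by (simp add: walk_rev)
      qed
      ultimately show "gc = hd"
        using t(1) u(1) by simp
    qed simp
  next
    fix gc assume gc: "gc \<in> walk ` lists (set J') \<times> snd ` set cs"
    obtain t c where t: "gc = (walk t, c)" "set t \<subseteq> set J'" "c \<in> snd ` set cs"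
      using gc by (auto simp: lists_eq_set)
    have "set (t @ c) \<subseteq> set J"
      using t(2,3) word J(1) by fastforce
    then show "?f gc \<in> walk ` lists (set J)"
      using t(1) by (intro image_eqI[of _ _ "t @ c"]) (auto simp: walk_append)
  next
    fix g assume "g \<in> walk ` lists (set J)"
    then obtain w where w: "set w \<subseteq> set J" "g = walk w"
      by (auto simp: lists_eq_set)
    obtain c t where ct: "c \<in> snd ` set cs" "set t \<subseteq> set J'" "walk w = walk t \<circ> walk c"
      using decompose[OF w(1)] by blast
    then show "\<exists>gc\<in>walk ` lists (set J') \<times> snd ` set cs. g = ?f gc"
      using w(2) by (intro bexI[of _ "(walk t, c)"]) (auto simp: lists_eq_set)
  qed
  then have "card (walk ` lists (set J)) = card (walk ` lists (set J')) * card (snd ` set cs)"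
    by (simp add: bij_betw_same_card[symmetric] card_cartesian_product)
  moreover have "card (snd ` set cs) = length cs"
  proof -
    have "fst jc = track (snd jc) b" if "jc \<in> set cs" for jc
      using word[of "fst jc" "snd jc"] that by simp
    then have "inj_on snd (set cs)"
      by (intro inj_onI prod_eqI) simp_all
    then show ?thesis
      using dist by (simp add: card_image distinct_card distinct_map)
  qed
  ultimately show ?thesis
    using assms(2) by simp
qed

lemmas transversal_check = coset_step_def indices_def probes_def perm_simps

text \<open>The chain of parabolic subgroups has types \<open>E6\<close>, \<open>D5\<close>,
  \<open>D4\<close>, \<open>A3\<close>, \<open>A1 x A1\<close>, \<open>A1\<close> and trivial, with
  indices 27, 10, 8, 6, 2, 2.\<close>

lemma transversal_1: "transversal [1, 2, 3, 4, 5, 6] [1, 2, 3, 4, 6] 9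
    [(9, []), (12, [5]), (15, [5, 4]), (23, [5, 4, 3]), (22, [5, 4, 3, 2]), (26, [5, 4, 3, 6]),
     (21, [5, 4, 3, 2, 1]), (25, [5, 4, 3, 2, 6]), (24, [5, 4, 3, 2, 1, 6]),
     (2, [5, 4, 3, 2, 6, 3]), (5, [5, 4, 3, 2, 1, 6, 3]), (1, [5, 4, 3, 2, 6, 3, 4]),
     (8, [5, 4, 3, 2, 1, 6, 3, 2]), (4, [5, 4, 3, 2, 1, 6, 3, 4]),
     (0, [5, 4, 3, 2, 6, 3, 4, 5]), (7, [5, 4, 3, 2, 1, 6, 3, 2, 4]),
     (3, [5, 4, 3, 2, 1, 6, 3, 4, 5]), (11, [5, 4, 3, 2, 1, 6, 3, 2, 4, 3]),
     (6, [5, 4, 3, 2, 1, 6, 3, 2, 4, 5]), (14, [5, 4, 3, 2, 1, 6, 3, 2, 4, 3, 5]),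
     (10, [5, 4, 3, 2, 1, 6, 3, 2, 4, 3, 6]), (17, [5, 4, 3, 2, 1, 6, 3, 2, 4, 3, 5, 4]),
     (13, [5, 4, 3, 2, 1, 6, 3, 2, 4, 3, 5, 6]), (16, [5, 4, 3, 2, 1, 6, 3, 2, 4, 3, 5, 4, 6]),
     (20, [5, 4, 3, 2, 1, 6, 3, 2, 4, 3, 5, 4, 6, 3]),
     (19, [5, 4, 3, 2, 1, 6, 3, 2, 4, 3, 5, 4, 6, 3, 2]),
     (18, [5, 4, 3, 2, 1, 6, 3, 2, 4, 3, 5, 4, 6, 3, 2, 1])]"
  unfolding transversal_def
  by (intro conjI allI impI) (simp_all add: transversal_check)

lemma transversal_2: "transversal [1, 2, 3, 4, 6] [2, 3, 4, 6] 0
    [(0, []), (3, [1]), (6, [1, 2]), (14, [1, 2, 3]), (17, [1, 2, 3, 4]), (13, [1, 2, 3, 6]),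
     (16, [1, 2, 3, 4, 6]), (20, [1, 2, 3, 4, 6, 3]), (19, [1, 2, 3, 4, 6, 3, 2]),
     (18, [1, 2, 3, 4, 6, 3, 2, 1])]"
  unfolding transversal_def
  by (intro conjI allI impI) (simp_all add: transversal_check)

lemma transversal_3: "transversal [2, 3, 4, 6] [2, 3, 6] 1
    [(1, []), (2, [4]), (25, [4, 3]), (26, [4, 3, 2]), (22, [4, 3, 6]), (23, [4, 3, 2, 6]),
     (15, [4, 3, 2, 6, 3]), (12, [4, 3, 2, 6, 3, 4])]"
  unfolding transversal_def
  by (intro conjI allI impI) (simp_all add: transversal_check)

lemma transversal_4: "transversal [2, 3, 6] [2, 6] 2
    [(2, []), (25, [3]), (26, [3, 2]), (22, [3, 6]), (23, [3, 2, 6]), (15, [3, 2, 6, 3])]"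
  unfolding transversal_def
  by (intro conjI allI impI) (simp_all add: transversal_check)

lemma transversal_5: "transversal [2, 6] [6] 3
    [(3, []), (6, [2])]"
  unfolding transversal_def
  by (intro conjI allI impI) (simp_all add: transversal_check)

lemma transversal_6: "transversal [6] [] 10
    [(10, []), (11, [6])]"
  unfolding transversal_def
  by (intro conjI allI impI) (simp_all add: transversal_check)

lemma card_WT: "card WT = 51840"
proof -
  have "card (walk ` lists (set [1, 2, 3, 4, 5, 6])) = 27 * card (walk ` lists (set [1, 2, 3, 4, 6]))"
    by (rule card_transversal[OF transversal_1]) simp
  moreover have "card (walk ` lists (set [1, 2, 3, 4, 6])) = 10 * card (walk ` lists (set [2, 3, 4, 6]))"
    by (rule card_transversal[OF transversal_2]) simp
  moreover have "card (walk ` lists (set [2, 3, 4, 6])) = 8 * card (walk ` lists (set [2, 3, 6]))"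
    by (rule card_transversal[OF transversal_3]) simp
  moreover have "card (walk ` lists (set [2, 3, 6])) = 6 * card (walk ` lists (set [2, 6]))"
    by (rule card_transversal[OF transversal_4]) simp
  moreover have "card (walk ` lists (set [2, 6])) = 2 * card (walk ` lists (set [6]))"
    by (rule card_transversal[OF transversal_5]) simp
  moreover have "card (walk ` lists (set [6])) = 2 * card (walk ` lists (set ([] :: nat list)))"
    by (rule card_transversal[OF transversal_6]) simp
  moreover have "card (walk ` lists (set ([] :: nat list))) = 1"
    by simp
  ultimately have "card (walk ` lists (set [1, 2, 3, 4, 5, 6])) = 51840"
    by (simp only:)
  moreover have "{1..6} = set [1, 2, 3, 4, 5, 6 :: nat]"
    by auto
  ultimately show ?thesis
    by (simp only: WT_def)
qed

section \<open>Averaging functions on the parameter space\<close>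

definition average :: "(point \<Rightarrow> complex) \<Rightarrow> point \<Rightarrow> complex" where
  "average \<phi> \<mu> = (\<Sum>t\<in>WT. \<phi> (t \<mu>)) / 51840"

lemma peval_W_average: "peval \<mu> (W_average f) = average (\<lambda>\<nu>. peval \<nu> f) \<mu>"
proof -
  have "(\<Sum>w\<in>W_E6. peval \<mu> (w f)) = (\<Sum>w\<in>W_E6. peval (transform w \<mu>) f)"
    by (intro sum.cong peval_W refl)
  also have "\<dots> = (\<Sum>t\<in>WT. peval (t \<mu>) f)"
    unfolding transform_W[symmetric] by (simp add: sum.reindex[OF inj_on_transform])
  finally show ?thesis
    by (simp add: W_average_def average_def peval_simps)
qed

lemma WT_closed_walk:
  assumes "set w \<subseteq> {1..6}" "t \<in> WT"
  shows "walk w \<circ> t \<in> WT" "t \<circ> walk w \<in> WT"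
proof -
  obtain u where "set u \<subseteq> {1..6}" "t = walk u"
    using assms(2) by (auto simp: WT_def lists_eq_set)
  with assms(1) show "walk w \<circ> t \<in> WT" "t \<circ> walk w \<in> WT"
    unfolding WT_def lists_eq_set by (auto simp flip: walk_append intro!: imageI)
qed

text \<open>Composition with a fixed group element permutes the group; the reversed word gives the
  inverse permutation.\<close>

lemma average_walk:
  assumes "set w \<subseteq> {1..6}"
  shows "average (\<lambda>\<nu>. \<phi> (walk w \<nu>)) \<mu> = average \<phi> \<mu>"
proof -
  have "(\<Sum>t\<in>WT. \<phi> (walk w (t \<mu>))) = (\<Sum>t\<in>WT. \<phi> (t \<mu>))"
    using assms
    by (intro sum.reindex_bij_witness[of _ "\<lambda>t. walk (rev w) \<circ> t" "\<lambda>t. walk w \<circ> t"])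
      (auto simp: WT_closed_walk walk_rev fun_eq_iff)
  then show ?thesis
    by (simp add: average_def)
qed

lemma average_add: "average (\<lambda>\<nu>. \<phi> \<nu> + \<psi> \<nu>) \<mu> = average \<phi> \<mu> + average \<psi> \<mu>"
  by (simp add: average_def sum.distrib add_divide_distrib)

lemma average_cmult: "average (\<lambda>\<nu>. c * \<phi> \<nu>) \<mu> = c * average \<phi> \<mu>"
  by (simp add: average_def sum_distrib_left)

lemma average_diff: "average (\<lambda>\<nu>. \<phi> \<nu> - \<psi> \<nu>) \<mu> = average \<phi> \<mu> - average \<psi> \<mu>"
  by (simp add: average_def sum_subtractf diff_divide_distrib)

section \<open>Invariant functions and power sums of the weights\<close>

definition invariant :: "(point \<Rightarrow> complex) \<Rightarrow> bool" where
  "invariant \<psi> \<longleftrightarrow> (\<forall>s\<in>{1..6}. \<forall>\<nu>. \<psi> (reflect s \<nu>) = \<psi> \<nu>)"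

lemma invariant_WT: "invariant \<psi> \<Longrightarrow> t \<in> WT \<Longrightarrow> \<psi> (t \<mu>) = \<psi> \<mu>"
proof -
  assume inv: "invariant \<psi>" and "t \<in> WT"
  then obtain w where "set w \<subseteq> {1..6}" "t = walk w"
    by (auto simp: WT_def lists_eq_set)
  moreover have "\<psi> (walk w \<mu>) = \<psi> \<mu>" if "set w \<subseteq> {1..6}" for w
    using that inv by (induction w) (simp_all add: invariant_def)
  ultimately show ?thesis
    by simp
qed

lemma invariant_const: "invariant (\<lambda>\<nu>. c)"
  and invariant_add: "invariant \<phi> \<Longrightarrow> invariant \<psi> \<Longrightarrow> invariant (\<lambda>\<nu>. \<phi> \<nu> + \<psi> \<nu>)"
  and invariant_diff: "invariant \<phi> \<Longrightarrow> invariant \<psi> \<Longrightarrow> invariant (\<lambda>\<nu>. \<phi> \<nu> - \<psi> \<nu>)"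
  and invariant_mult: "invariant \<phi> \<Longrightarrow> invariant \<psi> \<Longrightarrow> invariant (\<lambda>\<nu>. \<phi> \<nu> * \<psi> \<nu>)"
  and invariant_power: "invariant \<phi> \<Longrightarrow> invariant (\<lambda>\<nu>. \<phi> \<nu> ^ n)"
  by (simp_all add: invariant_def)

lemma average_invariant: "invariant \<psi> \<Longrightarrow> average (\<lambda>\<nu>. \<psi> \<nu> * \<phi> \<nu>) \<mu> = \<psi> \<mu> * average \<phi> \<mu>"
  by (simp add: average_def invariant_WT sum_distrib_left)

text \<open>This is where the order of the group enters; the preceding rules hold for any
  normalising divisor.\<close>

lemma average_const: "average (\<lambda>\<nu>. c) \<mu> = c"
  by (simp add: average_def card_WT)

definition power_sum :: "nat \<Rightarrow> point \<Rightarrow> complex" where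
  "power_sum n \<mu> = (\<Sum>u\<leftarrow>weights \<mu>. u ^ n)"

lemma power_sum_eq: "power_sum n \<mu> = (\<Sum>i\<in>set indices. weight i \<mu> ^ n)"
proof -
  have "distinct indices"
    by (simp add: indices_eq)
  then show ?thesis
    by (simp add: power_sum_def comp_def flip: weight_values sum_list_distinct_conv_sum_set)
qed

text \<open>Follows from the involutivity of the reflections, since different indices carry
  different weights.\<close>

lemma perm_involution:
  assumes "s \<in> {1..6}" "i \<in> set indices"
  shows "perm s (perm s i) = i"
proof (rule weight_inject)
  show "weight (perm s (perm s i)) = weight i"
    using assms weight_reflect[of s "perm s i"] weight_reflect[of s i]
    by (intro ext) (metis perm_closed reflect_involution)
qed (use assms in \<open>simp_all add: perm_closed\<close>)

lemma invariant_power_sum: "invariant (power_sum n)"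
  unfolding invariant_def power_sum_eq
proof (intro ballI allI)
  fix s \<nu> assume s: "s \<in> {1..6 :: nat}"
  then have "(\<Sum>i\<in>set indices. weight i (reflect s \<nu>) ^ n) = (\<Sum>i\<in>set indices. weight (perm s i) \<nu> ^ n)"
    by (intro sum.cong) (simp_all add: weight_reflect)
  also have "\<dots> = (\<Sum>i\<in>set indices. weight i \<nu> ^ n)"
    using s
    by (intro sum.reindex_bij_witness[of _ "perm s" "perm s"])
      (simp_all add: perm_closed perm_involution)
  finally show "(\<Sum>i\<in>set indices. weight i (reflect s \<nu>) ^ n) = (\<Sum>i\<in>set indices. weight i \<nu> ^ n)" .
qed

lemmas invariant_intros = invariant_const invariant_add invariant_diff invariant_mult
  invariant_power invariant_power_sum


section \<open>Averaging over the subgroup of type \<open>A\<^sub>2 \<times> A\<^sub>2 \<times> A\<^sub>2\<close>\<close>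

text \<open>The six pairs are the orbit of Dynkin labels under the Weyl group of
  \<open>sl(3)\<close>: first the rotations, then the reflections.\<close>

definition S3_average :: "(complex \<Rightarrow> complex \<Rightarrow> complex) \<Rightarrow> complex \<Rightarrow> complex \<Rightarrow> complex" where
  "S3_average g a b = (g a b + g (- (a + b)) a + g b (- (a + b))
     + g (a + b) (- b) + g (- b) (- a) + g (- a) (a + b)) / 6"

text \<open>On the pair, \<open>u\<close> acts as a 3-cycle and \<open>v\<close> as a transposition,
  and both fix the cofactor \<open>h\<close>. All six resulting functions therefore have the same
  average.\<close>

lemma average_S3:
  assumes words: "set u \<subseteq> {1..6}" "set v \<subseteq> {1..6}"
    and u: "\<And>\<nu>. a (walk u \<nu>) = - (a \<nu> + b \<nu>)" "\<And>\<nu>. b (walk u \<nu>) = a \<nu>" "\<And>\<nu>. h (walk u \<nu>) = h \<nu>"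
    and v: "\<And>\<nu>. a (walk v \<nu>) = a \<nu> + b \<nu>" "\<And>\<nu>. b (walk v \<nu>) = - b \<nu>" "\<And>\<nu>. h (walk v \<nu>) = h \<nu>"
  shows "average (\<lambda>\<nu>. g (a \<nu>) (b \<nu>) * h \<nu>) \<mu> = average (\<lambda>\<nu>. S3_average g (a \<nu>) (b \<nu>) * h \<nu>) \<mu>"
proof -
  define \<phi> where "\<phi> \<nu> = g (a \<nu>) (b \<nu>) * h \<nu>" for \<nu>
  define \<psi> where "\<psi> \<nu> = g (a \<nu> + b \<nu>) (- b \<nu>) * h \<nu>" for \<nu>
  have rot: "average (\<lambda>\<nu>. \<chi> \<nu> + \<chi> (walk u \<nu>) + \<chi> (walk u (walk u \<nu>))) \<mu> = 3 * average \<chi> \<mu>" for \<chi>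
    using average_walk[OF words(1), of \<chi>] average_walk[OF words(1), of "\<lambda>\<nu>. \<chi> (walk u \<nu>)"]
    by (simp add: average_add)
  have "average \<psi> \<mu> = average \<phi> \<mu>"
    using average_walk[OF words(2), of \<phi> \<mu>] by (simp add: \<phi>_def \<psi>_def[abs_def] v)
  then have "average \<phi> \<mu> = average (\<lambda>\<nu>. (1 / 6) * ((\<phi> \<nu> + \<phi> (walk u \<nu>) + \<phi> (walk u (walk u \<nu>)))
      + (\<psi> \<nu> + \<psi> (walk u \<nu>) + \<psi> (walk u (walk u \<nu>))))) \<mu>"
    unfolding average_cmult average_add[of "\<lambda>\<nu>. \<phi> \<nu> + \<phi> (walk u \<nu>) + \<phi> (walk u (walk u \<nu>))"] rot
    by simp
  also have "(\<lambda>\<nu>. (1 / 6) * ((\<phi> \<nu> + \<phi> (walk u \<nu>) + \<phi> (walk u (walk u \<nu>)))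
      + (\<psi> \<nu> + \<psi> (walk u \<nu>) + \<psi> (walk u (walk u \<nu>))))) = (\<lambda>\<nu>. S3_average g (a \<nu>) (b \<nu>) * h \<nu>)"
    by (rule ext) (simp add: \<phi>_def \<psi>_def u S3_average_def algebra_simps)
  finally show ?thesis
    by (simp add: \<phi>_def[abs_def])
qed

lemma weight_walk_simps:
  assumes "set w \<subseteq> {1..6}"
  shows "weight 0 (walk w \<nu>) = weight (track w 0) \<nu>" "weight 1 (walk w \<nu>) = weight (track w 1) \<nu>"
    "weight 3 (walk w \<nu>) = weight (track w 3) \<nu>" "weight 6 (walk w \<nu>) = weight (track w 6) \<nu>"
    "weight 9 (walk w \<nu>) = weight (track w 9) \<nu>" "weight 10 (walk w \<nu>) = weight (track w 10) \<nu>"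
  using assms by (simp_all add: weight_walk indices_eq del: One_nat_def)

text \<open>In the third factor \<open>M1''\<close> is the longest root, whose reflection is not a
  generator. The rotation therefore needs a long word, unlike \<open>[1, 2]\<close> and
  \<open>[5, 4]\<close> in the other factors.\<close>

definition rotation_word :: "nat list" where
  "rotation_word = [6, 3, 2, 1, 4, 3, 2, 5, 4, 3, 6, 3, 2, 1, 4, 3, 2, 5, 4, 3]"

lemma rotation_words:
  "walk [1, 2] \<nu> = \<nu>(M1 := - (\<nu> M1 + \<nu> M2), M2 := \<nu> M1)"
  "walk [5, 4] \<nu> = \<nu>(M1' := - (\<nu> M1' + \<nu> M2'), M2' := \<nu> M1')"
  "walk rotation_word \<nu> = \<nu>(M1'' := - (\<nu> M1'' + \<nu> M2''), M2'' := \<nu> M1'')"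
proof -
  show "walk [1, 2] \<nu> = \<nu>(M1 := - (\<nu> M1 + \<nu> M2), M2 := \<nu> M1)"
    "walk [5, 4] \<nu> = \<nu>(M1' := - (\<nu> M1' + \<nu> M2'), M2' := \<nu> M1')"
    by (simp_all add: reflect_def fun_eq_iff)
  have "set rotation_word \<subseteq> {1..6}"
    by (simp add: rotation_word_def)
  note eqs = weight_walk_simps[OF this, unfolded rotation_word_def One_nat_def]
  have "\<forall>i\<in>set probes.
      weight i (walk rotation_word \<nu>) = weight i (\<nu>(M1'' := - (\<nu> M1'' + \<nu> M2''), M2'' := \<nu> M1''))"
    unfolding probes_def rotation_word_def
    by (simp add: eqs perm_simps del: walk.simps) (simp add: weight_simps field_simps)
  then show "walk rotation_word \<nu> = \<nu>(M1'' := - (\<nu> M1'' + \<nu> M2''), M2'' := \<nu> M1'')"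
    by (intro point_eqI) blast
qed

lemma average_product:
  "average (\<lambda>\<nu>. f (\<nu> M1) (\<nu> M2) * g (\<nu> M1') (\<nu> M2') * h (\<nu> M1'') (\<nu> M2'')) \<mu> =
   average (\<lambda>\<nu>. S3_average f (\<nu> M1) (\<nu> M2) * S3_average g (\<nu> M1') (\<nu> M2') * S3_average h (\<nu> M1'') (\<nu> M2'')) \<mu>"
proof -
  have x: "average (\<lambda>\<nu>. f (\<nu> M1) (\<nu> M2) * (g (\<nu> M1') (\<nu> M2') * h (\<nu> M1'') (\<nu> M2''))) \<mu> =
      average (\<lambda>\<nu>. S3_average f (\<nu> M1) (\<nu> M2) * (g (\<nu> M1') (\<nu> M2') * h (\<nu> M1'') (\<nu> M2''))) \<mu>" for f g h
    by (rule average_S3[of "[1, 2]" "[2]"])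
      (simp_all add: rotation_words del: walk.simps, simp_all add: reflect_def)
  have y: "average (\<lambda>\<nu>. g (\<nu> M1') (\<nu> M2') * (f (\<nu> M1) (\<nu> M2) * h (\<nu> M1'') (\<nu> M2''))) \<mu> =
      average (\<lambda>\<nu>. S3_average g (\<nu> M1') (\<nu> M2') * (f (\<nu> M1) (\<nu> M2) * h (\<nu> M1'') (\<nu> M2''))) \<mu>" for f g h
    by (rule average_S3[of "[5, 4]" "[4]"])
      (simp_all add: rotation_words del: walk.simps, simp_all add: reflect_def)
  have "set rotation_word \<subseteq> {1..6}"
    by (simp add: rotation_word_def)
  then have z: "average (\<lambda>\<nu>. h (\<nu> M1'') (\<nu> M2'') * (f (\<nu> M1) (\<nu> M2) * g (\<nu> M1') (\<nu> M2'))) \<mu> =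
      average (\<lambda>\<nu>. S3_average h (\<nu> M1'') (\<nu> M2'') * (f (\<nu> M1) (\<nu> M2) * g (\<nu> M1') (\<nu> M2'))) \<mu>" for f g h
    by (intro average_S3[of rotation_word "[6]"])
      (simp_all add: rotation_words del: walk.simps, simp_all add: reflect_def)
  show ?thesis
    using x[of f g h] y[of g "S3_average f" h] z[of h "S3_average f" "S3_average g"]
    by (simp add: mult_ac)
qed

text \<open>The mean of the powers of the three roots of \<open>t^3 + p * t - q\<close>, by Newton's
  recurrence.\<close>

fun power_mean :: "complex \<Rightarrow> complex \<Rightarrow> nat \<Rightarrow> complex" where
  "power_mean p q 0 = 1"
| "power_mean p q (Suc 0) = 0"
| "power_mean p q (Suc (Suc 0)) = - (2 / 3) * p"
| "power_mean p q (Suc (Suc (Suc n))) = - p * power_mean p q (Suc n) + q * power_mean p q n"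

text \<open>The mean of \<open>x^j * (y - z)^(2 * n)\<close> over the cyclic arrangements of the
  roots \<open>x, y, z\<close>.\<close>

primrec moment :: "complex \<Rightarrow> complex \<Rightarrow> nat \<Rightarrow> nat \<Rightarrow> complex" where
  "moment p q 0 = (\<lambda>j. power_mean p q j)"
| "moment p q (Suc n) = (\<lambda>j. - 4 * p * moment p q n j - 3 * moment p q n (j + 2))"

lemma power_mean_eq:
  fixes x y z :: complex
  assumes "x + y + z = 0"
  shows "power_mean (x * y + x * z + y * z) (x * y * z) n = (x ^ n + y ^ n + z ^ n) / 3"
proof -
  have z: "z = - x - y"
    using assms by (simp add: algebra_simps eq_neg_iff_add_eq_0)
  show ?thesis
  proof (induction "x * y + x * z + y * z" "x * y * z" n rule: power_mean.induct)
    case 3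
    show ?case
      unfolding z by (simp add: power2_eq_square field_simps)
  next
    case (4 n)
    have cubic: "x ^ 3 = - (x * y + x * z + y * z) * x + x * y * z"
      "y ^ 3 = - (x * y + x * z + y * z) * y + x * y * z"
      "z ^ 3 = - (x * y + x * z + y * z) * z + x * y * z"
      unfolding z by (simp_all add: power3_eq_cube algebra_simps)
    have step: "u ^ Suc (Suc (Suc n)) = - (x * y + x * z + y * z) * u ^ Suc n + x * y * z * u ^ n"
      if "u ^ 3 = - (x * y + x * z + y * z) * u + x * y * z" for u
    proof -
      have "u ^ Suc (Suc (Suc n)) = u ^ 3 * u ^ n"
        by (simp add: power3_eq_cube)
      then show ?thesis
        unfolding that by (simp add: algebra_simps)
    qed
    show ?case
      unfolding power_mean.simps 4 step[OF cubic(1)] step[OF cubic(2)] step[OF cubic(3)]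
      by (simp add: field_simps del: power_Suc)
  qed (use assms in simp_all)
qed

lemma moment_eq:
  fixes x y z :: complex
  assumes "x + y + z = 0"
  shows "moment (x * y + x * z + y * z) (x * y * z) n j =
    (x ^ j * (y - z) ^ (2 * n) + y ^ j * (z - x) ^ (2 * n) + z ^ j * (x - y) ^ (2 * n)) / 3"
proof (induction n arbitrary: j)
  case 0
  show ?case
    using assms by (simp add: power_mean_eq)
next
  case (Suc n)
  have z: "z = - x - y"
    using assms by (simp add: algebra_simps eq_neg_iff_add_eq_0)
  let ?p = "x * y + x * z + y * z"
  \<comment> \<open>For roots with sum zero, the squared difference of two of them is a polynomial
    in the third. This yields the recurrence in \<open>n\<close>.\<close>
  have discr: "(y - z)\<^sup>2 = - 4 * ?p - 3 * x\<^sup>2" "(z - x)\<^sup>2 = - 4 * ?p - 3 * y\<^sup>2" "(x - y)\<^sup>2 = - 4 * ?p - 3 * z\<^sup>2"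
    unfolding z by (simp_all add: power2_eq_square algebra_simps)
  have "u ^ (2 * Suc n) = u\<^sup>2 * u ^ (2 * n)" for u :: complex
    by (simp add: power2_eq_square)
  then show ?case
    by (simp only: moment.simps Suc.IH discr power_add) (simp add: field_simps)
qed

section \<open>Relations between averages\<close>

text \<open>\<open>e2\<close> and \<open>e3\<close> are the elementary symmetric functions of
  \<open>triple a b\<close>; the first one vanishes.\<close>

definition e2 :: "complex \<Rightarrow> complex \<Rightarrow> complex" where
  "e2 a b = - ((a\<^sup>2 + a * b + b\<^sup>2) / 3)"

definition e3 :: "complex \<Rightarrow> complex \<Rightarrow> complex" where
  "e3 a b = - ((2 * a + b) * (b - a) * (a + 2 * b) / 27)"

lemma triple_sum: "(2 * a + b) / 3 + (b - a) / 3 + - ((a + 2 * b) / 3) = (0 :: complex)"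
  by (simp add: field_simps)

lemma triple_e2_e3:
  "(2 * a + b) / 3 * ((b - a) / 3) + (2 * a + b) / 3 * - ((a + 2 * b) / 3)
     + (b - a) / 3 * - ((a + 2 * b) / 3) = e2 a b"
  "(2 * a + b) / 3 * ((b - a) / 3) * - ((a + 2 * b) / 3) = e3 a b"
  by (simp_all add: e2_def e3_def power2_eq_square field_simps)

lemma e2_e3_uminus: "e2 (- a) (- b) = e2 a b" "e3 (- a) (- b) = - e3 a b"
  by (simp_all add: e2_def e3_def field_simps)

text \<open>Each entry of the triple occurs for two of the six pairs, together with plus or minus
  the difference of the other two; the even exponent removes the sign.\<close>

lemma S3_average_moment:
  "S3_average (\<lambda>a b. (- ((a + 2 * b) / 3)) ^ j * a ^ (2 * n)) a b = moment (e2 a b) (e3 a b) n j"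
proof -
  have even: "(- u) ^ (2 * n) = u ^ (2 * n)" for u :: complex
    by (simp add: power_mult)
  have diffs: "(2 * a + b) / 3 - (b - a) / 3 = a" "(b - a) / 3 - - ((a + 2 * b) / 3) = b"
    "- ((a + 2 * b) / 3) - (2 * a + b) / 3 = - (a + b)"
    by (simp_all add: field_simps)
  have args: "- ((- (a + b) + 2 * a) / 3) = (b - a) / 3" "- ((b + 2 * - (a + b)) / 3) = (2 * a + b) / 3"
    "- ((a + b + 2 * - b) / 3) = (b - a) / 3" "- ((- b + 2 * - a) / 3) = (2 * a + b) / 3"
    "- ((- a + 2 * (a + b)) / 3) = - ((a + 2 * b) / 3)"
    by (simp_all add: field_simps)
  note M = moment_eq[OF triple_sum[of a b], of n j, unfolded triple_e2_e3 diffs even]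
  show ?thesis
    unfolding M S3_average_def args even by simp
qed

definition px :: "point \<Rightarrow> complex" where "px \<nu> = e2 (\<nu> M1) (\<nu> M2)"
definition qx :: "point \<Rightarrow> complex" where "qx \<nu> = e3 (\<nu> M1) (\<nu> M2)"
definition py :: "point \<Rightarrow> complex" where "py \<nu> = e2 (\<nu> M1') (\<nu> M2')"
definition qy :: "point \<Rightarrow> complex" where "qy \<nu> = e3 (\<nu> M1') (\<nu> M2')"
definition pz :: "point \<Rightarrow> complex" where "pz \<nu> = e2 (\<nu> M1'') (\<nu> M2'')"
definition qz :: "point \<Rightarrow> complex" where "qz \<nu> = - e3 (\<nu> M1'') (\<nu> M2'')"

type_synonym coord_fun = "complex \<Rightarrow> complex \<Rightarrow> complex \<Rightarrow> complex \<Rightarrow> complex \<Rightarrow> complex \<Rightarrow> complex"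

definition at_coords :: "coord_fun \<Rightarrow> point \<Rightarrow> complex" where
  "at_coords F \<nu> = F (px \<nu>) (qx \<nu>) (py \<nu>) (qy \<nu>) (pz \<nu>) (qz \<nu>)"

text \<open>
  The factors on the left are powers of \<open>x\<^sub>3\<close>, \<open>y\<^sub>3\<close>, \<open>z\<^sub>3\<close>; the third has the opposite sign since \<open>z\<close> is the
  triple of \<open>(- m1'', - m2'')\<close>.
\<close>

lemma average_moments:
  "average (\<lambda>\<nu>. ((- ((\<nu> M1 + 2 * \<nu> M2) / 3)) ^ i * \<nu> M1 ^ (2 * l)) *
       ((- ((\<nu> M1' + 2 * \<nu> M2') / 3)) ^ j * \<nu> M1' ^ (2 * m)) *
       (((\<nu> M1'' + 2 * \<nu> M2'') / 3) ^ k * \<nu> M1'' ^ (2 * n))) \<mu> =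
   average (\<lambda>\<nu>. moment (px \<nu>) (qx \<nu>) l i * moment (py \<nu>) (qy \<nu>) m j * moment (pz \<nu>) (qz \<nu>) n k) \<mu>"
proof -
  have "S3_average (\<lambda>a b. ((a + 2 * b) / 3) ^ k * a ^ (2 * n)) a b = moment (e2 a b) (- e3 a b) n k" for a b
  proof -
    have neg: "(- ((- c + 2 * - d) / 3)) ^ k * (- c) ^ (2 * n) = ((c + 2 * d) / 3) ^ k * c ^ (2 * n)"
      for c d :: complex
    proof -
      have "- ((- c + 2 * - d) / 3) = (c + 2 * d) / 3"
        by (simp add: field_simps)
      then show ?thesis
        by (simp only: power_mult power2_minus)
    qed
    have "S3_average g (- a) (- b) = S3_average (\<lambda>c d. g (- c) (- d)) a b" for g
      by (simp add: S3_average_def algebra_simps)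
    from this[of "\<lambda>a b. (- ((a + 2 * b) / 3)) ^ k * a ^ (2 * n)"] show ?thesis
      unfolding S3_average_moment neg e2_e3_uminus by simp
  qed
  then show ?thesis
    unfolding px_def qx_def py_def qy_def pz_def qz_def
    by (simp only: average_product[of "\<lambda>a b. (- ((a + 2 * b) / 3)) ^ i * a ^ (2 * l)"
          "\<lambda>a b. (- ((a + 2 * b) / 3)) ^ j * a ^ (2 * m)" "\<lambda>a b. ((a + 2 * b) / 3) ^ k * a ^ (2 * n)"]
        S3_average_moment)
qed

section \<open>Functions with vanishing average\<close>

definition null :: "(point \<Rightarrow> complex) \<Rightarrow> bool" where
  "null \<phi> \<longleftrightarrow> (\<forall>\<mu>. average \<phi> \<mu> = 0)"

lemma null_add: "null \<phi> \<Longrightarrow> null \<psi> \<Longrightarrow> null (\<lambda>\<nu>. \<phi> \<nu> + \<psi> \<nu>)"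
  and null_diff: "null \<phi> \<Longrightarrow> null \<psi> \<Longrightarrow> null (\<lambda>\<nu>. \<phi> \<nu> - \<psi> \<nu>)"
  and null_mult: "invariant \<psi> \<Longrightarrow> null \<phi> \<Longrightarrow> null (\<lambda>\<nu>. \<psi> \<nu> * \<phi> \<nu>)"
  by (simp_all add: null_def average_add average_diff average_invariant)

definition rel_odd :: "nat \<Rightarrow> nat \<Rightarrow> nat \<Rightarrow> coord_fun" where
  "rel_odd l m n pa qa pb qb pc qc =
     moment pa qa l 1 * moment pb qb m 0 * moment pc qc n 0
     + moment pa qa l 0 * moment pb qb m 1 * moment pc qc n 0
     + moment pa qa l 0 * moment pb qb m 0 * moment pc qc n 1"

text \<open>The four terms are those of
  \<open>(x + y + z) * (y - z) = x * y - x * z + y^2 - z^2\<close> for the last entries of the three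
  triples.\<close>

definition rel_even :: "nat \<Rightarrow> nat \<Rightarrow> nat \<Rightarrow> coord_fun" where
  "rel_even l m n pa qa pb qb pc qc =
     moment pa qa l 1 * moment pb qb m 1 * moment pc qc n 0
     - moment pa qa l 1 * moment pb qb m 0 * moment pc qc n 1
     + moment pa qa l 0 * moment pb qb m 2 * moment pc qc n 0
     - moment pa qa l 0 * moment pb qb m 0 * moment pc qc n 2"

text \<open>
  The reflection \<open>s\<^sub>3\<close> negates \<open>\<alpha>\<^sub>3 = x\<^sub>3 + y\<^sub>3 + z\<^sub>3\<close> and fixes \<open>m1\<close>, \<open>m1'\<close>, \<open>m1''\<close> and \<open>y\<^sub>3 - z\<^sub>3\<close>, so
  that \<open>\<alpha>\<^sub>3 m1\<^bsup>2l\<^esup> m1'\<^bsup>2m\<^esup> m1''\<^bsup>2n\<^esup>\<close> and its product with \<open>y\<^sub>3 - z\<^sub>3\<close> have average zero.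
\<close>

lemma average_antisymmetric:
  assumes "\<And>\<nu>. \<phi> (reflect 3 \<nu>) = - \<phi> \<nu>"
  shows "average \<phi> \<mu> = 0"
proof -
  have "walk [3] = reflect 3"
    by (simp add: fun_eq_iff)
  then have "average (\<lambda>\<nu>. - 1 * \<phi> \<nu>) \<mu> = average \<phi> \<mu>"
    using average_walk[of "[3]" \<phi> \<mu>] by (simp only: assms) simp
  then have "average \<phi> \<mu> + average \<phi> \<mu> = 0"
    unfolding average_cmult by (metis add.right_inverse mult_minus1)
  then show ?thesis
    by (simp flip: mult_2)
qed

lemma null_rel_odd: "null (at_coords (rel_odd l m n))"
  unfolding null_def
proof
  fix \<mu>
  define T where "T i j k \<nu> = ((- ((\<nu> M1 + 2 * \<nu> M2) / 3)) ^ i * \<nu> M1 ^ (2 * l)) *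
       ((- ((\<nu> M1' + 2 * \<nu> M2') / 3)) ^ j * \<nu> M1' ^ (2 * m)) *
       (((\<nu> M1'' + 2 * \<nu> M2'') / 3) ^ k * \<nu> M1'' ^ (2 * n))" for i j k and \<nu> :: point
  have eq: "T 1 0 0 \<nu> + T 0 1 0 \<nu> + T 0 0 1 \<nu> =
      alpha3 \<nu> * (\<nu> M1 ^ (2 * l) * \<nu> M1' ^ (2 * m) * \<nu> M1'' ^ (2 * n))" for \<nu>
    by (simp add: T_def alpha3_def field_simps)
  have "average (\<lambda>\<nu>. T 1 0 0 \<nu> + T 0 1 0 \<nu> + T 0 0 1 \<nu>) \<mu> = 0"
    unfolding eq by (rule average_antisymmetric) (simp add: reflect_def alpha3_def field_simps)
  then show "average (at_coords (rel_odd l m n)) \<mu> = 0"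
    unfolding average_add T_def average_moments
    by (simp only: at_coords_def[abs_def] rel_odd_def average_add)
qed

lemma null_rel_even: "null (at_coords (rel_even l m n))"
  unfolding null_def
proof
  fix \<mu>
  define T where "T i j k \<nu> = ((- ((\<nu> M1 + 2 * \<nu> M2) / 3)) ^ i * \<nu> M1 ^ (2 * l)) *
       ((- ((\<nu> M1' + 2 * \<nu> M2') / 3)) ^ j * \<nu> M1' ^ (2 * m)) *
       (((\<nu> M1'' + 2 * \<nu> M2'') / 3) ^ k * \<nu> M1'' ^ (2 * n))" for i j k and \<nu> :: point
  have eq: "T 1 1 0 \<nu> - T 1 0 1 \<nu> + T 0 2 0 \<nu> - T 0 0 2 \<nu> =
      alpha3 \<nu> * (- ((\<nu> M1' + 2 * \<nu> M2') / 3) - (\<nu> M1'' + 2 * \<nu> M2'') / 3) *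
      (\<nu> M1 ^ (2 * l) * \<nu> M1' ^ (2 * m) * \<nu> M1'' ^ (2 * n))" for \<nu>
    by (simp add: T_def alpha3_def power2_eq_square) (simp add: field_simps)
  have "average (\<lambda>\<nu>. T 1 1 0 \<nu> - T 1 0 1 \<nu> + T 0 2 0 \<nu> - T 0 0 2 \<nu>) \<mu> = 0"
    unfolding eq by (rule average_antisymmetric) (simp add: reflect_def alpha3_def field_simps)
  then show "average (at_coords (rel_even l m n)) \<mu> = 0"
    unfolding average_add average_diff T_def average_moments
    by (simp only: at_coords_def[abs_def] rel_even_def average_add average_diff)
qed

text \<open>
  The words \<open>cycle_word\<close> and \<open>swap_word\<close>, like \<open>rotation_word\<close>, were found by breadth-first search. They
  normalise the subgroup of type \<open>A\<^sub>2 \<times> A\<^sub>2 \<times> A\<^sub>2\<close> and permute its factors.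
\<close>

definition cycle_word :: "nat list" where
  "cycle_word = [3, 2, 1, 6, 3, 2, 4, 3, 5, 4, 6, 3]"

definition swap_word :: "nat list" where
  "swap_word = [3, 2, 1, 4, 3, 2, 5, 4, 3]"

lemma walk_cycle: "walk cycle_word \<nu> =
    \<nu>(M1 := \<nu> M1', M2 := \<nu> M2', M1' := - \<nu> M2'', M2' := \<nu> M1'' + \<nu> M2'', M1'' := \<nu> M1 + \<nu> M2, M2'' := - \<nu> M1)"
proof -
  have "set cycle_word \<subseteq> {1..6}"
    by (simp add: cycle_word_def)
  note eqs = weight_walk_simps[OF this, unfolded cycle_word_def One_nat_def]
  have "\<forall>i\<in>set probes. weight i (walk cycle_word \<nu>) = weight i
      (\<nu>(M1 := \<nu> M1', M2 := \<nu> M2', M1' := - \<nu> M2'', M2' := \<nu> M1'' + \<nu> M2'', M1'' := \<nu> M1 + \<nu> M2, M2'' := - \<nu> M1))"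
    unfolding probes_def cycle_word_def
    by (simp add: eqs perm_simps del: walk.simps) (simp add: weight_simps field_simps)
  then show ?thesis
    by (intro point_eqI) blast
qed

lemma walk_swap: "walk swap_word \<nu> =
    \<nu>(M1 := \<nu> M2', M2 := \<nu> M1', M1' := \<nu> M2, M2' := \<nu> M1, M2'' := - (\<nu> M1'' + \<nu> M2''))"
proof -
  have "set swap_word \<subseteq> {1..6}"
    by (simp add: swap_word_def)
  note eqs = weight_walk_simps[OF this, unfolded swap_word_def One_nat_def]
  have "\<forall>i\<in>set probes. weight i (walk swap_word \<nu>) = weight i
      (\<nu>(M1 := \<nu> M2', M2 := \<nu> M1', M1' := \<nu> M2, M2' := \<nu> M1, M2'' := - (\<nu> M1'' + \<nu> M2'')))"
    unfolding probes_def swap_word_def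
    by (simp add: eqs perm_simps del: walk.simps) (simp add: weight_simps field_simps)
  then show ?thesis
    by (intro point_eqI) blast
qed

lemma coords_cycle:
  "px (walk cycle_word \<nu>) = py \<nu>" "qx (walk cycle_word \<nu>) = qy \<nu>"
  "py (walk cycle_word \<nu>) = pz \<nu>" "qy (walk cycle_word \<nu>) = qz \<nu>"
  "pz (walk cycle_word \<nu>) = px \<nu>" "qz (walk cycle_word \<nu>) = qx \<nu>"
  by (simp_all add: walk_cycle px_def qx_def py_def qy_def pz_def qz_def e2_def e3_def
      power2_eq_square) (simp_all add: field_simps)

text \<open>The word sends each triple to a permuted negative of a triple, so exchanging two factors
  changes the sign of every cubic invariant.\<close>

lemma coords_swap:
  "px (walk swap_word \<nu>) = py \<nu>" "qx (walk swap_word \<nu>) = - qy \<nu>"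
  "py (walk swap_word \<nu>) = px \<nu>" "qy (walk swap_word \<nu>) = - qx \<nu>"
  "pz (walk swap_word \<nu>) = pz \<nu>" "qz (walk swap_word \<nu>) = - qz \<nu>"
  by (simp_all add: walk_swap px_def qx_def py_def qy_def pz_def qz_def e2_def e3_def
      power2_eq_square) (simp_all add: field_simps)

text \<open>Sums over the six permutations of the factors; the odd ones carry the signs from
  \<open>coords_swap\<close>.\<close>

definition symmetrize :: "coord_fun \<Rightarrow> coord_fun" where
  "symmetrize F pa qa pb qb pc qc =
     F pa qa pb qb pc qc + F pb qb pc qc pa qa + F pc qc pa qa pb qb
     + F pb (- qb) pa (- qa) pc (- qc) + F pa (- qa) pc (- qc) pb (- qb) + F pc (- qc) pb (- qb) pa (- qa)"

lemma average_symmetrize: "average (at_coords (symmetrize F)) \<mu> = 6 * average (at_coords F) \<mu>"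
proof -
  have words: "set cycle_word \<subseteq> {1..6}" "set swap_word \<subseteq> {1..6}"
    by (simp_all add: cycle_word_def swap_word_def)
  have cycle: "average (\<lambda>\<nu>. H (py \<nu>) (qy \<nu>) (pz \<nu>) (qz \<nu>) (px \<nu>) (qx \<nu>)) \<mu> =
      average (\<lambda>\<nu>. H (px \<nu>) (qx \<nu>) (py \<nu>) (qy \<nu>) (pz \<nu>) (qz \<nu>)) \<mu>" for H :: coord_fun
    using average_walk[OF words(1), of "at_coords H" \<mu>]
    by (simp add: at_coords_def[abs_def] coords_cycle)
  have swap: "average (\<lambda>\<nu>. H (py \<nu>) (- qy \<nu>) (px \<nu>) (- qx \<nu>) (pz \<nu>) (- qz \<nu>)) \<mu> =
      average (\<lambda>\<nu>. H (px \<nu>) (qx \<nu>) (py \<nu>) (qy \<nu>) (pz \<nu>) (qz \<nu>)) \<mu>" for H :: coord_fun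
    using average_walk[OF words(2), of "at_coords H" \<mu>]
    by (simp add: at_coords_def[abs_def] coords_swap)
  show ?thesis
    unfolding at_coords_def[abs_def] symmetrize_def average_add
    using cycle[of F] cycle[of "\<lambda>pa qa pb qb pc qc. F pb qb pc qc pa qa"] swap[of F]
      swap[of "\<lambda>pa qa pb qb pc qc. F pb qb pc qc pa qa"] swap[of "\<lambda>pa qa pb qb pc qc. F pc qc pa qa pb qb"]
    by simp
qed

lemma null_symmetrize: "null (at_coords F) \<Longrightarrow> null (at_coords (symmetrize F))"
  by (simp add: null_def average_symmetrize)

text \<open>The mean of \<open>(u + v)^n\<close> over roots \<open>u\<close> and \<open>v\<close> of
  two cubics. Negating \<open>q'\<close> replaces \<open>v\<close> by \<open>- v\<close>, which
  gives the differences of entries that make up the weights.\<close>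

definition pair_sum :: "nat \<Rightarrow> complex \<Rightarrow> complex \<Rightarrow> complex \<Rightarrow> complex \<Rightarrow> complex" where
  "pair_sum n p q p' q' = (\<Sum>m\<le>n. of_nat (n choose m) * power_mean p q m * power_mean p' q' (n - m))"

definition power_sum_coords :: "nat \<Rightarrow> coord_fun" where
  "power_sum_coords n pa qa pb qb pc qc =
     9 * (pair_sum n pa qa pb (- qb) + pair_sum n pb qb pc (- qc) + pair_sum n pc qc pa (- qa))"

lemma differences_power_sum:
  "(\<Sum>u\<leftarrow>differences [x1, x2, x3] [y1, y2, y3]. u ^ n) = 9 * (\<Sum>m\<le>n. of_nat (n choose m) *
     ((x1 ^ m + x2 ^ m + x3 ^ m) / 3) * (((- y1) ^ (n - m) + (- y2) ^ (n - m) + (- y3) ^ (n - m)) / 3))"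
proof -
  have "(u - v) ^ n = (\<Sum>m\<le>n. of_nat (n choose m) * u ^ m * (- v) ^ (n - m))" for u v :: complex
    using binomial_ring[of u "- v" n] by simp
  then show ?thesis
    by (simp only: differences_def list.map concat.simps append.simps append_Nil sum_list.Cons sum_list.Nil
        sum_distrib_left add_0_right sum.distrib[symmetric])
      (intro sum.cong refl, simp add: field_simps)
qed

lemma power_sum_coords: "power_sum n \<nu> = at_coords (power_sum_coords n) \<nu>"
proof -
  have pm: "((2 * a + b) / 3) ^ n + ((b - a) / 3) ^ n + (- ((a + 2 * b) / 3)) ^ n
      = 3 * power_mean (e2 a b) (e3 a b) n" for a b n
    using power_mean_eq[OF triple_sum[of a b], of n] unfolding triple_e2_e3 by (simp only:) simp
  have pm_neg: "(- ((2 * a + b) / 3)) ^ n + (- ((b - a) / 3)) ^ n + (- (- ((a + 2 * b) / 3))) ^ n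
      = 3 * power_mean (e2 a b) (- e3 a b) n" for a b n
  proof -
    have "(2 * - a + - b) / 3 = - ((2 * a + b) / 3)" "(- b - - a) / 3 = - ((b - a) / 3)"
      "- ((- a + 2 * - b) / 3) = - (- ((a + 2 * b) / 3))"
      by (simp_all add: field_simps)
    then show ?thesis
      using pm[of "- a" "- b" n] unfolding e2_e3_uminus by (simp only:)
  qed
  have "(\<Sum>u\<leftarrow>differences (triple a b) (triple c d). u ^ n) =
      9 * pair_sum n (e2 a b) (e3 a b) (e2 c d) (- e3 c d)" for a b c d
    unfolding triple_def differences_power_sum pm pm_neg pair_sum_def by simp
  then show ?thesis
    by (simp add: power_sum_def weights_def Let_def at_coords_def power_sum_coords_def
        px_def qx_def py_def qy_def pz_def qz_def e2_e3_uminus)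
qed

section \<open>The fundamental invariants in terms of power sums of weights\<close>

lemma power_mean_values:
  "power_mean p q 0 = 1"
  "power_mean p q 2 = - (2 / 3) * p"
  "power_mean p q 3 = q"
  "power_mean p q 4 = (2 / 3) * p ^ 2"
  "power_mean p q 5 = - (5 / 3) * p * q"
  "power_mean p q 6 = - (2 / 3) * p ^ 3 + q ^ 2"
  "power_mean p q 7 = (7 / 3) * p ^ 2 * q"
  "power_mean p q 8 = (2 / 3) * p ^ 4 - (8 / 3) * p * q ^ 2"
  "power_mean p q 9 = - 3 * p ^ 3 * q + q ^ 3"
  "power_mean p q 10 = - (2 / 3) * p ^ 5 + 5 * p ^ 2 * q ^ 2"
  "power_mean p q 12 = (2 / 3) * p ^ 6 - 8 * p ^ 3 * q ^ 2 + q ^ 4"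
  by (simp_all add: eval_nat_numeral) (simp_all add: field_simps)

lemma moment_values:
  "moment p q 0 0 = 1"
  "moment p q 0 1 = 0"
  "moment p q 0 2 = - (2 / 3) * p"
  "moment p q 1 0 = - 2 * p"
  "moment p q 1 1 = - 3 * q"
  "moment p q 1 2 = (2 / 3) * p ^ 2"
  "moment p q 2 0 = 6 * p ^ 2"
  "moment p q 2 1 = 9 * p * q"
  "moment p q 2 2 = - (2 / 3) * p ^ 3 + 9 * q ^ 2"
  "moment p q 3 0 = - 22 * p ^ 3 - 27 * q ^ 2"
  "moment p q 3 1 = - 27 * p ^ 2 * q"
  "moment p q 3 2 = (2 / 3) * p ^ 4 - 36 * p * q ^ 2"
  "moment p q 4 0 = 86 * p ^ 4 + 216 * p * q ^ 2"
  "moment p q 4 1 = 93 * p ^ 3 * q + 81 * q ^ 3"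
  "moment p q 4 2 = - (2 / 3) * p ^ 5 + 117 * p ^ 2 * q ^ 2"
  "moment p q 5 0 = - 342 * p ^ 5 - 1215 * p ^ 2 * q ^ 2"
  "moment p q 5 1 = - 351 * p ^ 4 * q - 729 * p * q ^ 3"
  "moment p q 5 2 = (2 / 3) * p ^ 6 - 396 * p ^ 3 * q ^ 2 - 243 * q ^ 4"
  by (simp_all add: eval_nat_numeral) (simp_all add: field_simps)

text \<open>The terms for \<open>m = 1\<close> and \<open>m = n - 1\<close> drop out because the
  first power mean is zero.\<close>

lemma pair_sum_values:
  "pair_sum 2 p q p' q' = power_mean p q 0 * power_mean p' q' 2
     + power_mean p q 2 * power_mean p' q' 0"
  "pair_sum 5 p q p' q' = power_mean p q 0 * power_mean p' q' 5
     + 10 * power_mean p q 2 * power_mean p' q' 3 + 10 * power_mean p q 3 * power_mean p' q' 2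
     + power_mean p q 5 * power_mean p' q' 0"
  "pair_sum 6 p q p' q' = power_mean p q 0 * power_mean p' q' 6
     + 15 * power_mean p q 2 * power_mean p' q' 4 + 20 * power_mean p q 3 * power_mean p' q' 3
     + 15 * power_mean p q 4 * power_mean p' q' 2 + power_mean p q 6 * power_mean p' q' 0"
  "pair_sum 8 p q p' q' = power_mean p q 0 * power_mean p' q' 8
     + 28 * power_mean p q 2 * power_mean p' q' 6 + 56 * power_mean p q 3 * power_mean p' q' 5
     + 70 * power_mean p q 4 * power_mean p' q' 4 + 56 * power_mean p q 5 * power_mean p' q' 3
     + 28 * power_mean p q 6 * power_mean p' q' 2 + power_mean p q 8 * power_mean p' q' 0"
  "pair_sum 9 p q p' q' = power_mean p q 0 * power_mean p' q' 9
     + 36 * power_mean p q 2 * power_mean p' q' 7 + 84 * power_mean p q 3 * power_mean p' q' 6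
     + 126 * power_mean p q 4 * power_mean p' q' 5 + 126 * power_mean p q 5 * power_mean p' q' 4
     + 84 * power_mean p q 6 * power_mean p' q' 3 + 36 * power_mean p q 7 * power_mean p' q' 2
     + power_mean p q 9 * power_mean p' q' 0"
  "pair_sum 12 p q p' q' = power_mean p q 0 * power_mean p' q' 12
     + 66 * power_mean p q 2 * power_mean p' q' 10 + 220 * power_mean p q 3 * power_mean p' q' 9
     + 495 * power_mean p q 4 * power_mean p' q' 8 + 792 * power_mean p q 5 * power_mean p' q' 7
     + 924 * power_mean p q 6 * power_mean p' q' 6 + 792 * power_mean p q 7 * power_mean p' q' 5
     + 495 * power_mean p q 8 * power_mean p' q' 4 + 220 * power_mean p q 9 * power_mean p' q' 3
     + 66 * power_mean p q 10 * power_mean p' q' 2 + power_mean p q 12 * power_mean p' q' 0"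
  by (simp_all add: pair_sum_def atMost_nat_numeral eval_nat_numeral)

text \<open>These six functions express \<open>p2\<close> to \<open>p12\<close> through power sums
  of the weights in the fundamental degrees 2, 5, 6, 8, 9, 12.\<close>

definition fundamental_2 :: coord_fun where
  "fundamental_2 pa qa pb qb pc qc = (let i = \<lambda>n. power_sum_coords n pa qa pb qb pc qc in
     (1 / 12) * i 2)"

definition fundamental_5 :: coord_fun where
  "fundamental_5 pa qa pb qb pc qc = (let i = \<lambda>n. power_sum_coords n pa qa pb qb pc qc in
     - (1 / 30) * i 5)"

definition fundamental_6 :: coord_fun where
  "fundamental_6 pa qa pb qb pc qc = (let i = \<lambda>n. power_sum_coords n pa qa pb qb pc qc in
     (1 / 36) * i 6 - (11 / 31104) * i 2 ^ 3)"

definition fundamental_8 :: coord_fun where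
  "fundamental_8 pa qa pb qb pc qc = (let i = \<lambda>n. power_sum_coords n pa qa pb qb pc qc in
     - (1 / 120) * i 8 + (83 / 25920) * i 2 * i 6 - (11 / 559872) * i 2 ^ 4)"

definition fundamental_9 :: coord_fun where
  "fundamental_9 pa qa pb qb pc qc = (let i = \<lambda>n. power_sum_coords n pa qa pb qb pc qc in
     - (1 / 378) * i 9 + (17 / 93312) * i 2 ^ 2 * i 5)"

definition fundamental_12 :: coord_fun where
  "fundamental_12 pa qa pb qb pc qc = (let i = \<lambda>n. power_sum_coords n pa qa pb qb pc qc in
     (1 / 810) * i 12 + (29 / 14580) * i 6 ^ 2 - (53 / 466560) * i 2 ^ 2 * i 8
     - (31 / 1049760) * i 2 ^ 3 * i 6 + (187 / 806215680) * i 2 ^ 6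
     - (43 / 291600) * i 2 * i 5 ^ 2)"

text \<open>Averaging the last assumption removes \<open>\<phi>\<close> and reproduces the invariant
  \<open>g\<close>, while symmetrising multiplies the average by 6.\<close>

lemma average_eqI:
  assumes "invariant (at_coords g)" "null \<phi>"
    and "\<And>\<nu>. at_coords (symmetrize F) \<nu> = 6 * at_coords g \<nu> + \<phi> \<nu>"
  shows "average (at_coords F) \<mu> = at_coords g \<mu>"
proof -
  have "6 * average (at_coords F) \<mu> = average (\<lambda>\<nu>. 6 * at_coords g \<nu> + \<phi> \<nu>) \<mu>"
    unfolding average_symmetrize[symmetric] by (rule arg_cong[where f = "\<lambda>\<phi>. average \<phi> \<mu>"]) (use assms(3) in blast)
  also have "\<dots> = 6 * average (\<lambda>\<nu>. at_coords g \<nu> * 1) \<mu>"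
    using assms(2) by (simp add: average_add average_cmult null_def)
  also have "\<dots> = 6 * at_coords g \<mu>"
    unfolding average_invariant[OF assms(1)] average_const by simp
  finally show ?thesis
    by simp
qed

lemma invariant_coords:
  "invariant (at_coords fundamental_2)"
  "invariant (at_coords fundamental_5)"
  "invariant (at_coords fundamental_6)"
  "invariant (at_coords fundamental_8)"
  "invariant (at_coords fundamental_9)"
  "invariant (at_coords fundamental_12)"
  unfolding at_coords_def[abs_def] fundamental_2_def fundamental_5_def fundamental_6_def fundamental_8_def fundamental_9_def fundamental_12_def Let_def
  \<comment> \<open>Folds the coordinate expressions back into power sums, whose invariance is
    known.\<close>
  unfolding power_sum_coords[unfolded at_coords_def, symmetric]
  by (intro invariant_intros)+

lemma null_zero: "null (\<lambda>\<nu>. 0)"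
  by (simp add: null_def average_const)

lemmas null_intros = null_zero null_add null_diff null_mult null_symmetrize null_rel_even
  null_rel_odd invariant_intros

abbreviation sym_even :: "nat \<Rightarrow> nat \<Rightarrow> nat \<Rightarrow> point \<Rightarrow> complex" where
  "sym_even l m n \<equiv> at_coords (symmetrize (rel_even l m n))"

abbreviation sym_odd :: "nat \<Rightarrow> nat \<Rightarrow> nat \<Rightarrow> point \<Rightarrow> complex" where
  "sym_odd l m n \<equiv> at_coords (symmetrize (rel_odd l m n))"

lemmas coords_simps = power_sum_coords at_coords_def symmetrize_def rel_even_def rel_odd_def
  power_sum_coords_def pair_sum_values power_mean_values moment_values Let_def
  fundamental_2_def fundamental_5_def fundamental_6_def fundamental_8_def fundamental_9_def fundamental_12_def


text \<open>
  The coefficients below solve a linear system in the space of polynomials of the respective degree in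
  the coordinates; the symmetrized relations, multiplied by power sums, span the kernel of the
  averaging map on the symmetrized polynomials of degree at most 12.
\<close>

lemma average_coords_2: "average (at_coords (\<lambda>pa qa pb qb pc qc. - 3 * pa)) \<mu> = at_coords fundamental_2 \<mu>"
  by (rule average_eqI[where \<phi> = "\<lambda>\<nu>. 0"],
      rule invariant_coords, (intro null_intros)[1],
      simp only: coords_simps, Groebner_Basis.algebra)

lemma average_coords_5: "average (at_coords (\<lambda>pa qa pb qb pc qc. 12 * qb * pc)) \<mu> = at_coords fundamental_5 \<mu>"
  by (rule average_eqI[where \<phi> = "\<lambda>\<nu>. 0"],
      rule invariant_coords, (intro null_intros)[1],
      simp only: coords_simps, Groebner_Basis.algebra)

text \<open>In degrees 2 and 5 symmetrising alone gives the power sum. From here on the correction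
  combines relations with power sums, every term having the degree of the monomial.\<close>

lemma average_coords_6: "average (at_coords (\<lambda>pa qa pb qb pc qc. 10 * pa * pb * pc)) \<mu> = at_coords fundamental_6 \<mu>"
  by (rule average_eqI[where \<phi> = "\<lambda>\<nu>. (1 / 6) * sym_even 0 0 2 \<nu>
     - (17 / 144) * power_sum 2 \<nu> * sym_even 0 0 1 \<nu> - (5 / 3) * sym_even 1 0 1 \<nu>"],
      rule invariant_coords, (intro null_intros)[1],
      simp only: coords_simps, Groebner_Basis.algebra)

lemma average_coords_8: "average (at_coords (\<lambda>pa qa pb qb pc qc. (135 / 4) * qa * qb * pc)) \<mu> = at_coords fundamental_8 \<mu>"
  by (rule average_eqI[where \<phi> = "\<lambda>\<nu>.
     (197 / 2592) * power_sum 2 \<nu> * sym_even 0 0 2 \<nu>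
     + (13 / 108) * power_sum 2 \<nu> * sym_even 1 0 1 \<nu>
     - (11 / 1728) * power_sum 2 \<nu> ^ 2 * sym_even 0 0 1 \<nu>
     - (11 / 54) * sym_even 0 0 3 \<nu> - (17 / 18) * sym_even 1 0 2 \<nu>"],
      rule invariant_coords, (intro null_intros)[1],
      simp only: coords_simps, Groebner_Basis.algebra)

lemma average_coords_9: "average (at_coords (\<lambda>pa qa pb qb pc qc. 20 * pa^2 * qb * pc)) \<mu> = at_coords fundamental_9 \<mu>"
  by (rule average_eqI[where \<phi> = "\<lambda>\<nu>.
     (1 / 144) * power_sum 5 \<nu> * sym_even 0 0 1 \<nu> + (4 / 27) * sym_odd 0 1 3 \<nu>
     - (10 / 243) * power_sum 2 \<nu> * sym_odd 0 1 2 \<nu>"],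
      rule invariant_coords, (intro null_intros)[1],
      simp only: coords_simps, Groebner_Basis.algebra)

lemma average_coords_12: "average (at_coords (\<lambda>pa qa pb qb pc qc. 180 * (pa * pb * pc)^2)) \<mu> = at_coords fundamental_12 \<mu>"
  by (rule average_eqI[where \<phi> = "\<lambda>\<nu>.
     (89707 / 2903040) * power_sum 8 \<nu> * sym_even 0 0 1 \<nu>
     + (59659 / 7464960) * power_sum 2 \<nu> * power_sum 6 \<nu> * sym_even 0 0 1 \<nu>
     + (42929179 / 7255941120) * power_sum 2 \<nu> ^ 3 * sym_even 0 0 2 \<nu>
     + (11231 / 8957952) * power_sum 2 \<nu> ^ 3 * sym_even 1 0 1 \<nu>
     + (6218005 / 35271936) * power_sum 2 \<nu> * sym_even 0 0 4 \<nu>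
     + (715993 / 5038848) * power_sum 2 \<nu> * sym_even 0 1 3 \<nu>
     + (167467 / 10077696) * power_sum 2 \<nu> ^ 2 * sym_even 1 0 2 \<nu>
     + (94357 / 1088640) * sym_even 0 1 4 \<nu> + (1669 / 1944) * sym_even 1 0 4 \<nu>
     + (10423 / 25920) * sym_even 0 2 3 \<nu>
     - (9724031 / 58047528960) * power_sum 2 \<nu> ^ 4 * sym_even 0 0 1 \<nu>
     - (1553 / 34560) * power_sum 6 \<nu> * sym_even 0 0 2 \<nu>
     - (103 / 1152) * power_sum 6 \<nu> * sym_even 1 0 1 \<nu>
     - (18845803 / 302330880) * power_sum 2 \<nu> ^ 2 * sym_even 0 0 3 \<nu>
     - (47011 / 1399680) * power_sum 5 \<nu> * sym_odd 0 1 2 \<nu>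
     - (76135 / 314928) * power_sum 2 \<nu> * sym_even 1 0 3 \<nu>
     - (5939 / 155520) * sym_even 0 0 5 \<nu>"],
      rule invariant_coords, (intro null_intros)[1],
      simp only: coords_simps, Groebner_Basis.algebra)

section \<open>Averages of the monomials defining the fundamental invariants\<close>

lemma S3_average_values:
  "S3_average (\<lambda>a b. 1) a b = 1"
  "S3_average (\<lambda>a b. a\<^sup>2) a b = - 2 * e2 a b"
  "S3_average (\<lambda>a b. a * b) a b = e2 a b"
  "S3_average (\<lambda>a b. a\<^sup>2 * b) a b = 9 / 2 * e3 a b"
  "S3_average (\<lambda>a b. (a * b)\<^sup>2) a b = 3 * (e2 a b)\<^sup>2"
  unfolding S3_average_def e2_def e3_def by Groebner_Basis.algebra+

lemma average_monomial:
  assumes "\<And>\<nu>. \<phi> \<nu> = f (\<nu> M1) (\<nu> M2) * g (\<nu> M1') (\<nu> M2') * h (\<nu> M1'') (\<nu> M2'')"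
    and "\<And>\<nu>. c * (S3_average f (\<nu> M1) (\<nu> M2) * S3_average g (\<nu> M1') (\<nu> M2') *
      S3_average h (\<nu> M1'') (\<nu> M2'')) = at_coords F \<nu>"
  shows "c * average \<phi> \<mu> = average (at_coords F) \<mu>"
proof -
  have "\<phi> = (\<lambda>\<nu>. f (\<nu> M1) (\<nu> M2) * g (\<nu> M1') (\<nu> M2') * h (\<nu> M1'') (\<nu> M2''))"
    using assms(1) by blast
  moreover have "at_coords F = (\<lambda>\<nu>. c * (S3_average f (\<nu> M1) (\<nu> M2) *
      S3_average g (\<nu> M1') (\<nu> M2') * S3_average h (\<nu> M1'') (\<nu> M2'')))"
    using assms(2) by presburger
  ultimately show ?thesis
    by (simp only: average_product[of f g h] average_cmult)
qed

lemmas monomial_simps = S3_average_values at_coords_def px_def qx_def py_def qy_def pz_def qz_def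

text \<open>The coefficients in \<open>average_coords_2\<close> to \<open>average_coords_12\<close>
  are the normalising factors times the constants of \<open>S3_average_values\<close>, for instance
  \<open>(5 / 3) * (9 / 2)^2 = 135 / 4\<close>.\<close>

lemma average_values:
  "3 / 2 * average (\<lambda>\<nu>. (\<nu> M1)\<^sup>2) \<mu> = at_coords fundamental_2 \<mu>"
  "8 / 3 * average (\<lambda>\<nu>. (\<nu> M1')\<^sup>2 * \<nu> M2' * \<nu> M1'' * \<nu> M2'') \<mu> = at_coords fundamental_5 \<mu>"
  "10 * average (\<lambda>\<nu>. \<nu> M1 * \<nu> M2 * \<nu> M1' * \<nu> M2' * \<nu> M1'' * \<nu> M2'') \<mu> = at_coords fundamental_6 \<mu>"
  "5 / 3 * average (\<lambda>\<nu>. (\<nu> M1)\<^sup>2 * \<nu> M2 * (\<nu> M1')\<^sup>2 * \<nu> M2' * \<nu> M1'' * \<nu> M2'') \<mu> = at_coords fundamental_8 \<mu>"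
  "40 / 27 * average (\<lambda>\<nu>. (\<nu> M1 * \<nu> M2 * \<nu> M1')\<^sup>2 * \<nu> M2' * \<nu> M1'' * \<nu> M2'') \<mu> = at_coords fundamental_9 \<mu>"
  "20 / 3 * average (\<lambda>\<nu>. (\<nu> M1 * \<nu> M2 * \<nu> M1' * \<nu> M2' * \<nu> M1'' * \<nu> M2'')\<^sup>2) \<mu> = at_coords fundamental_12 \<mu>"
proof -
  show "3 / 2 * average (\<lambda>\<nu>. (\<nu> M1)\<^sup>2) \<mu> = at_coords fundamental_2 \<mu>"
    unfolding average_coords_2[symmetric]
    by (rule average_monomial[of _ "\<lambda>a b. a\<^sup>2" "\<lambda>a b. 1" "\<lambda>a b. 1"])
      (simp add: power_mult_distrib, simp only: monomial_simps, simp add: power_mult_distrib)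
  show "8 / 3 * average (\<lambda>\<nu>. (\<nu> M1')\<^sup>2 * \<nu> M2' * \<nu> M1'' * \<nu> M2'') \<mu> = at_coords fundamental_5 \<mu>"
    unfolding average_coords_5[symmetric]
    by (rule average_monomial[of _ "\<lambda>a b. 1" "\<lambda>a b. a\<^sup>2 * b" "\<lambda>a b. a * b"])
      (simp add: power_mult_distrib, simp only: monomial_simps, simp add: power_mult_distrib)
  show "10 * average (\<lambda>\<nu>. \<nu> M1 * \<nu> M2 * \<nu> M1' * \<nu> M2' * \<nu> M1'' * \<nu> M2'') \<mu> = at_coords fundamental_6 \<mu>"
    unfolding average_coords_6[symmetric]
    by (rule average_monomial[of _ "\<lambda>a b. a * b" "\<lambda>a b. a * b" "\<lambda>a b. a * b"])
      (simp add: power_mult_distrib, simp only: monomial_simps, simp add: power_mult_distrib)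
  show "5 / 3 * average (\<lambda>\<nu>. (\<nu> M1)\<^sup>2 * \<nu> M2 * (\<nu> M1')\<^sup>2 * \<nu> M2' * \<nu> M1'' * \<nu> M2'') \<mu> = at_coords fundamental_8 \<mu>"
    unfolding average_coords_8[symmetric]
    by (rule average_monomial[of _ "\<lambda>a b. a\<^sup>2 * b" "\<lambda>a b. a\<^sup>2 * b" "\<lambda>a b. a * b"])
      (simp add: power_mult_distrib, simp only: monomial_simps, simp add: power_mult_distrib)
  show "40 / 27 * average (\<lambda>\<nu>. (\<nu> M1 * \<nu> M2 * \<nu> M1')\<^sup>2 * \<nu> M2' * \<nu> M1'' * \<nu> M2'') \<mu> = at_coords fundamental_9 \<mu>"
    unfolding average_coords_9[symmetric]
    by (rule average_monomial[of _ "\<lambda>a b. (a * b)\<^sup>2" "\<lambda>a b. a\<^sup>2 * b" "\<lambda>a b. a * b"])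
      (simp add: power_mult_distrib, simp only: monomial_simps, simp add: power_mult_distrib)
  show "20 / 3 * average (\<lambda>\<nu>. (\<nu> M1 * \<nu> M2 * \<nu> M1' * \<nu> M2' * \<nu> M1'' * \<nu> M2'')\<^sup>2) \<mu> = at_coords fundamental_12 \<mu>"
    unfolding average_coords_12[symmetric]
    by (rule average_monomial[of _ "\<lambda>a b. (a * b)\<^sup>2" "\<lambda>a b. (a * b)\<^sup>2" "\<lambda>a b. (a * b)\<^sup>2"])
      (simp add: power_mult_distrib, simp only: monomial_simps, simp add: power_mult_distrib)
qed

lemma peval_fundamental:
  "peval \<mu> p2 = at_coords fundamental_2 \<mu>" "peval \<mu> p5 = at_coords fundamental_5 \<mu>" "peval \<mu> p6 = at_coords fundamental_6 \<mu>"
  "peval \<mu> p8 = at_coords fundamental_8 \<mu>" "peval \<mu> p9 = at_coords fundamental_9 \<mu>" "peval \<mu> p12 = at_coords fundamental_12 \<mu>"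
  by (simp_all only: p2_def p5_def p6_def p8_def p9_def p12_def peval_simps peval_W_average average_values)

lemma peval_fundamental_transform:
  assumes "w \<in> W_E6"
  shows "peval (transform w \<mu>) p2 = peval \<mu> p2" "peval (transform w \<mu>) p5 = peval \<mu> p5"
    "peval (transform w \<mu>) p6 = peval \<mu> p6" "peval (transform w \<mu>) p8 = peval \<mu> p8"
    "peval (transform w \<mu>) p9 = peval \<mu> p9" "peval (transform w \<mu>) p12 = peval \<mu> p12"
proof -
  have "transform w \<in> WT"
    using assms transform_W by blast
  then show "peval (transform w \<mu>) p2 = peval \<mu> p2" "peval (transform w \<mu>) p5 = peval \<mu> p5"
    "peval (transform w \<mu>) p6 = peval \<mu> p6" "peval (transform w \<mu>) p8 = peval \<mu> p8"
    "peval (transform w \<mu>) p9 = peval \<mu> p9" "peval (transform w \<mu>) p12 = peval \<mu> p12"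
    by (simp_all only: peval_fundamental invariant_WT[OF invariant_coords(1)]
        invariant_WT[OF invariant_coords(2)] invariant_WT[OF invariant_coords(3)]
        invariant_WT[OF invariant_coords(4)] invariant_WT[OF invariant_coords(5)]
        invariant_WT[OF invariant_coords(6)])
qed


section \<open>The structure constants\<close>

definition kl_point :: "complex \<Rightarrow> complex \<Rightarrow> complex \<Rightarrow> complex \<Rightarrow> complex \<Rightarrow> complex \<Rightarrow> kl \<Rightarrow> complex" where
  "kl_point ka kb kc la lb lc = case_kl (case_idx ka kb kc) (case_idx la lb lc)"

lemma kl_point_simps:
  "kl_point ka kb kc la lb lc (K I1) = ka" "kl_point ka kb kc la lb lc (K I2) = kb"
  "kl_point ka kb kc la lb lc (K I3) = kc" "kl_point ka kb kc la lb lc (L I1) = la"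
  "kl_point ka kb kc la lb lc (L I2) = lb" "kl_point ka kb kc la lb lc (L I3) = lc"
  by (simp_all add: kl_point_def)

lemma kl_point_eta: "\<kappa> = kl_point (\<kappa> (K I1)) (\<kappa> (K I2)) (\<kappa> (K I3)) (\<kappa> (L I1)) (\<kappa> (L I2)) (\<kappa> (L I3))"
proof
  fix v show "\<kappa> v = kl_point (\<kappa> (K I1)) (\<kappa> (K I2)) (\<kappa> (K I3)) (\<kappa> (L I1)) (\<kappa> (L I2)) (\<kappa> (L I3)) v"
  proof (cases v)
    case (K i) then show ?thesis by (cases i) (simp_all add: kl_point_simps)
  next
    case (L i) then show ?thesis by (cases i) (simp_all add: kl_point_simps)
  qed
qed

lemma peval_kl_values:
  "peval \<mu> (subst kl_values f) = peval (kl_point (- 2 * px \<mu> - 2) (- 2 * py \<mu> - 2) (- 2 * pz \<mu> - 2)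
     (3 * qx \<mu>) (3 * qy \<mu>) (3 * qz \<mu>)) f"
proof -
  have c2: "peval \<mu> (c2 x y) = - 2 * e2 (peval \<mu> x) (peval \<mu> y) - 2" for x y
    by (simp add: c2_def e2_def peval_simps field_simps)
  \<comment> \<open>The summand \<open>3 / 2 * c2\<close> in \<open>kl_values\<close> cancels the
    quadratic and constant parts of this, leaving three times the cubic invariant.\<close>
  have c3: "peval \<mu> (c3 x y) = 3 * e3 (peval \<mu> x) (peval \<mu> y) + 3 * e2 (peval \<mu> x) (peval \<mu> y) + 3"
    for x y
    unfolding c3_def e2_def e3_def peval_simps by Groebner_Basis.algebra
  have "(\<lambda>v. peval \<mu> (kl_values v)) = kl_point (- 2 * px \<mu> - 2) (- 2 * py \<mu> - 2) (- 2 * pz \<mu> - 2)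
     (3 * qx \<mu>) (3 * qy \<mu>) (3 * qz \<mu>)"
    by (subst kl_point_eta)
      (simp add: peval_simps c2 c3 px_def qx_def py_def qy_def pz_def qz_def field_simps)
  then show ?thesis
    by (simp add: peval_subst)
qed

lemma sum_permutations_idx:
  fixes f :: "(idx \<Rightarrow> idx) \<Rightarrow> complex"
  shows "(\<Sum>\<pi> | \<pi> permutes UNIV. f \<pi>) =
    f id + f (transpose I2 I3) + f (transpose I1 I2) + f (transpose I1 I2 \<circ> transpose I2 I3)
    + f (transpose I1 I3) + f (transpose I1 I3 \<circ> transpose I2 I3)"
proof -
  have idx: "(UNIV :: idx set) = {I1, I2, I3}"
    using idx.exhaust by blast
  have mem: "finite {I2, I3}" "I1 \<notin> {I2, I3}" "finite {I3}" "I2 \<notin> {I3}"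
    by simp_all
  show ?thesis
    unfolding idx sum_over_permutations_insert[OF mem(1,2)] sum_over_permutations_insert[OF mem(3,4)]
      permutes_sing
    by (simp add: add_ac)
qed

lemma peval_Sym:
  "peval (kl_point ka kb kc la lb lc) (Sym_plus f) =
     1 / 6 * (peval (kl_point ka kb kc la lb lc) f + peval (kl_point kb kc ka lb lc la) f
      + peval (kl_point kc ka kb lc la lb) f + peval (kl_point kb ka kc lb la lc) f
      + peval (kl_point ka kc kb la lc lb) f + peval (kl_point kc kb ka lc lb la) f)"
  "peval (kl_point ka kb kc la lb lc) (Sym_minus f) =
     1 / 6 * (peval (kl_point ka kb kc la lb lc) f + peval (kl_point kb kc ka lb lc la) f
      + peval (kl_point kc ka kb lc la lb) f - peval (kl_point kb ka kc lb la lc) f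
      - peval (kl_point ka kc kb la lc lb) f - peval (kl_point kc kb ka lc lb la) f)"
proof -
  let ?\<kappa> = "kl_point ka kb kc la lb lc"
  have act: "peval ?\<kappa> (perm_act \<pi> f) = peval (kl_point (?\<kappa> (K (\<pi> I1))) (?\<kappa> (K (\<pi> I2))) (?\<kappa> (K (\<pi> I3)))
      (?\<kappa> (L (\<pi> I1))) (?\<kappa> (L (\<pi> I2))) (?\<kappa> (L (\<pi> I3)))) f" for \<pi>
    unfolding perm_act_def peval_subst by (subst kl_point_eta) (simp add: peval_simps)
  have sign: "sign (transpose I1 I2 \<circ> transpose I2 I3) = 1" "sign (transpose I1 I3 \<circ> transpose I2 I3) = 1"
    by (simp_all add: sign_compose permutation_swap_id sign_swap_id)
  show "peval ?\<kappa> (Sym_plus f) =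
     1 / 6 * (peval (kl_point ka kb kc la lb lc) f + peval (kl_point kb kc ka lb lc la) f
      + peval (kl_point kc ka kb lc la lb) f + peval (kl_point kb ka kc lb la lc) f
      + peval (kl_point ka kc kb la lc lb) f + peval (kl_point kc kb ka lc lb la) f)"
    unfolding Sym_plus_def peval_simps sum_permutations_idx act
    by (simp add: kl_point_simps transpose_def)
  show "peval ?\<kappa> (Sym_minus f) =
     1 / 6 * (peval (kl_point ka kb kc la lb lc) f + peval (kl_point kb kc ka lb lc la) f
      + peval (kl_point kc ka kb lc la lb) f - peval (kl_point kb ka kc lb la lc) f
      - peval (kl_point ka kc kb la lc lb) f - peval (kl_point kc kb ka lc lb la) f)"
    unfolding Sym_minus_def peval_simps sum_permutations_idx act sign
    by (simp add: kl_point_simps transpose_def sign_swap_id)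
qed

text \<open>Both sides evaluate to polynomials in the six coordinates \<open>px\<close> to
  \<open>qz\<close>, so each equation becomes a polynomial identity in six variables.\<close>

lemma structure_constants:
  "a2 = p2 - 3"
  "a5 = - p5"
  "a6 = p6 + Const (1/9) * p2^3 + Const (2/3) * p2^2 - Const (3/2) * p2 + 1"
  "a8 = - p8 + Const (1/54) * p2^4 + Const (1/12) * p2 * p6 + Const (1/18) * p2^3
            + Const (1/2) * p6 + Const (1/6) * p2^2 - Const (1/4) * p2 + Const (1/8)"
  "a9 = - p9 - p5 * (Const (1/27) * p2^2 + Const (1/3) * p2 - Const (1/4))"
  "a12 = - p12 + Const (35/12) * p6^2 + Const (1/36) * p2^6 + Const (17/72) * p2^3 * p6
            - Const (1/18) * p2^2 * p8 - Const (7/18) * p2 * p5^2 + Const (1/162) * p2^5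
            - Const (1/3) * p2 * p8 + Const (1/36) * p2^2 * p6 - Const (1/4) * p5^2
            - Const (13/108) * p2^4 + Const (13/2) * p8 - Const (13/24) * p2 * p6
            - Const (19/54) * p2^3 - 3 * p6 - Const (11/12) * p2^2 + Const (11/8) * p2
            - Const (11/16)"
  by (rule peval_eqI,
      simp only: a2_def a5_def a6_def a8_def a9_def a12_def peval_kl_values
        a2_kl_def a5_kl_def a6_kl_def a8_kl_def a9_kl_def a12_kl_def peval_Sym peval_simps
        kl_point_simps peval_fundamental coords_simps,
      Groebner_Basis.algebra)+

text \<open>Invariance is read off from the expressions in the fundamental invariants.\<close>

lemma peval_structure_constants_transform:
  assumes "w \<in> W_E6"
  shows "peval (transform w \<mu>) a2 = peval \<mu> a2" "peval (transform w \<mu>) a5 = peval \<mu> a5"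
    "peval (transform w \<mu>) a6 = peval \<mu> a6" "peval (transform w \<mu>) a8 = peval \<mu> a8"
    "peval (transform w \<mu>) a9 = peval \<mu> a9" "peval (transform w \<mu>) a12 = peval \<mu> a12"
  by (simp_all only: structure_constants peval_simps peval_fundamental_transform[OF assms])

theorem theorem5p1:
  shows
    "(\<forall>w\<in>W_E6. \<forall>\<mu>. Z2_relations (transform w \<mu>) = Z2_relations \<mu>
                     \<and> Z2_spec (transform w \<mu>) = Z2_spec \<mu>)
   \<and> a2 = p2 - 3
   \<and> a5 = - p5
   \<and> a6 = p6 + Const (1/9) * p2^3 + Const (2/3) * p2^2 - Const (3/2) * p2 + 1
   \<and> a8 = - p8 + Const (1/54) * p2^4 + Const (1/12) * p2 * p6 + Const (1/18) * p2^3
            + Const (1/2) * p6 + Const (1/6) * p2^2 - Const (1/4) * p2 + Const (1/8)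
   \<and> a9 = - p9 - p5 * (Const (1/27) * p2^2 + Const (1/3) * p2 - Const (1/4))
   \<and> a12 = - p12 + Const (35/12) * p6^2 + Const (1/36) * p2^6 + Const (17/72) * p2^3 * p6
            - Const (1/18) * p2^2 * p8 - Const (7/18) * p2 * p5^2 + Const (1/162) * p2^5
            - Const (1/3) * p2 * p8 + Const (1/36) * p2^2 * p6 - Const (1/4) * p5^2
            - Const (13/108) * p2^4 + Const (13/2) * p8 - Const (13/24) * p2 * p6
            - Const (19/54) * p2^3 - 3 * p6 - Const (11/12) * p2^2 + Const (11/8) * p2
            - Const (11/16)"
proof (intro conjI ballI allI)
  fix w \<mu> assume "w \<in> W_E6"
  \<comment> \<open>The relations depend on the parameters only through the values of the six
    structure constants.\<close>
  then show "Z2_relations (transform w \<mu>) = Z2_relations \<mu>"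
    by (simp only: Z2_relations_def peval_structure_constants_transform)
  then show "Z2_spec (transform w \<mu>) = Z2_spec \<mu>"
    by (simp only: Z2_spec_def)
qed (rule structure_constants)+

end
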